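(* Let $Q$ be a finite group, let $F_1,F_2$ be finitely generated non-abelian free groups, let $A$ be a free factor of both $F_1$ and $F_2$, and for $i=1,2$ let $\pi_i:F_i\to Q$ be a surjective homomorphism. Then $$Th^{+}_{A}(F_1,\pi_1)=Th^{+}_{A}(F_2,\pi_2),$$ i.e. the structures $(F_1,\pi_1)$ and $(F_2,\pi_2)$ satisfy exactly the same positive $\mathcal L^Q$-sentences with constants from $A$.
   Context: $\mathcal L^Q$ is the language of groups $\{1,\cdot,{}^{-1}\}$ expanded by one unary predicate $P_q$ for each $q\in Q$. A pair $(G,\pi)$, with $\pi:G\to Q$ a homomorphism, is regarded as an $\mathcal L^Q$-structure by interpreting $P_q$ as $\pi^{-1}(q)$. A formula is positive if it is built without use of the negation symbol, i.e. from atomic formulas using only $\wedge,\vee,\exists,\forall$. For $A\subset G$, $Th^+_A(G,\pi)$ is the set of positive sentences, in the language $\mathcal L^Q$ expanded by constants for the elements of $A$, that are true in $(G,\pi)$.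
   Formalization: The formal theorem additionally assumes that π_1 and π_2 agree on A; this is necessary, since for a in A the positive sentence P_q(a) holds in (F_i, π_i) exactly when π_i(a) = q. *)

theory Defs
  imports "HOL-Algebra.Generated_Groups"
begin

section \<open>Free groups and free factors\<close>

text \<open>
  A letter \<open>(True, x)\<close> stands for \<open>x\<close> and \<open>(False, x)\<close> for the inverse of \<open>x\<close>. A group is free
  on \<open>X\<close> if every element is the value of exactly one reduced word in the letters over \<open>X\<close>.
\<close>

definition letter_val :: "('a, 'm) monoid_scheme \<Rightarrow> bool \<times> 'a \<Rightarrow> 'a" where
  "letter_val G l = (if fst l then snd l else inv\<^bsub>G\<^esub> (snd l))"

definition list_prod :: "('a, 'm) monoid_scheme \<Rightarrow> 'a list \<Rightarrow> 'a" where
  "list_prod G gs = foldr (mult G) gs \<one>\<^bsub>G\<^esub>"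

definition reduced_words :: "'a set \<Rightarrow> (bool \<times> 'a) list set" where
  "reduced_words X =
     {w. snd ` set w \<subseteq> X \<and> successively (\<lambda>k l. snd k = snd l \<longrightarrow> fst k = fst l) w}"

definition free_basis :: "('a, 'm) monoid_scheme \<Rightarrow> 'a set \<Rightarrow> bool" where
  "free_basis G X \<longleftrightarrow> X \<subseteq> carrier G \<and>
     bij_betw (\<lambda>w. list_prod G (map (letter_val G) w)) (reduced_words X) (carrier G)"

definition free_group :: "('a, 'm) monoid_scheme \<Rightarrow> bool" where
  "free_group G \<longleftrightarrow> group G \<and> (\<exists>X. free_basis G X)"

definition finitely_generated :: "('a, 'm) monoid_scheme \<Rightarrow> bool" where
  "finitely_generated G \<longleftrightarrow> (\<exists>S. finite S \<and> S \<subseteq> carrier G \<and> generate G S = carrier G)"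

text \<open>
  Normal forms in the internal free product of \<open>H\<close> and \<open>K\<close>: alternating words of non-trivial
  elements, where the tag \<open>True\<close> marks an element of \<open>H\<close> and \<open>False\<close> one of \<open>K\<close>. Because of the
  tags, bijectivity below also forces \<open>H\<close> and \<open>K\<close> to intersect trivially.
\<close>

definition alternating_words ::
    "('a, 'm) monoid_scheme \<Rightarrow> 'a set \<Rightarrow> 'a set \<Rightarrow> (bool \<times> 'a) list set" where
  "alternating_words G H K =
     {w. (\<forall>l \<in> set w. snd l \<in> (if fst l then H else K) \<and> snd l \<noteq> \<one>\<^bsub>G\<^esub>) \<and>
         successively (\<lambda>k l. fst k \<noteq> fst l) w}"

definition is_free_product :: "('a, 'm) monoid_scheme \<Rightarrow> 'a set \<Rightarrow> 'a set \<Rightarrow> bool" where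
  "is_free_product G H K \<longleftrightarrow> subgroup H G \<and> subgroup K G \<and>
     bij_betw (\<lambda>w. list_prod G (map snd w)) (alternating_words G H K) (carrier G)"

definition free_factor :: "'a set \<Rightarrow> ('a, 'm) monoid_scheme \<Rightarrow> bool" where
  "free_factor A G \<longleftrightarrow> (\<exists>B. is_free_product G A B)"

section \<open>First-order formulas over the language of groups with predicates\<close>

datatype 'c trm =
    Var nat
  | Const 'c
  | One
  | Mult "'c trm" "'c trm"
  | Inv "'c trm"

datatype ('c, 'q) fm =
    Eq "'c trm" "'c trm"
  | Pred 'q "'c trm"
  | Neg "('c, 'q) fm"
  | Conj "('c, 'q) fm" "('c, 'q) fm"
  | Disj "('c, 'q) fm" "('c, 'q) fm"
  | Exi nat "('c, 'q) fm"
  | Uni nat "('c, 'q) fm"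

primrec trm_vars :: "'c trm \<Rightarrow> nat set" where
  "trm_vars (Var n) = {n}"
| "trm_vars (Const c) = {}"
| "trm_vars One = {}"
| "trm_vars (Mult s t) = trm_vars s \<union> trm_vars t"
| "trm_vars (Inv t) = trm_vars t"

primrec free_vars :: "('c, 'q) fm \<Rightarrow> nat set" where
  "free_vars (Eq s t) = trm_vars s \<union> trm_vars t"
| "free_vars (Pred q t) = trm_vars t"
| "free_vars (Neg \<phi>) = free_vars \<phi>"
| "free_vars (Conj \<phi> \<psi>) = free_vars \<phi> \<union> free_vars \<psi>"
| "free_vars (Disj \<phi> \<psi>) = free_vars \<phi> \<union> free_vars \<psi>"
| "free_vars (Exi n \<phi>) = free_vars \<phi> - {n}"
| "free_vars (Uni n \<phi>) = free_vars \<phi> - {n}"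

primrec trm_constants :: "'c trm \<Rightarrow> 'c set" where
  "trm_constants (Var n) = {}"
| "trm_constants (Const c) = {c}"
| "trm_constants One = {}"
| "trm_constants (Mult s t) = trm_constants s \<union> trm_constants t"
| "trm_constants (Inv t) = trm_constants t"

primrec constants :: "('c, 'q) fm \<Rightarrow> 'c set" where
  "constants (Eq s t) = trm_constants s \<union> trm_constants t"
| "constants (Pred q t) = trm_constants t"
| "constants (Neg \<phi>) = constants \<phi>"
| "constants (Conj \<phi> \<psi>) = constants \<phi> \<union> constants \<psi>"
| "constants (Disj \<phi> \<psi>) = constants \<phi> \<union> constants \<psi>"
| "constants (Exi n \<phi>) = constants \<phi>"
| "constants (Uni n \<phi>) = constants \<phi>"

primrec predicates :: "('c, 'q) fm \<Rightarrow> 'q set" where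
  "predicates (Eq s t) = {}"
| "predicates (Pred q t) = {q}"
| "predicates (Neg \<phi>) = predicates \<phi>"
| "predicates (Conj \<phi> \<psi>) = predicates \<phi> \<union> predicates \<psi>"
| "predicates (Disj \<phi> \<psi>) = predicates \<phi> \<union> predicates \<psi>"
| "predicates (Exi n \<phi>) = predicates \<phi>"
| "predicates (Uni n \<phi>) = predicates \<phi>"

primrec positive :: "('c, 'q) fm \<Rightarrow> bool" where
  "positive (Eq s t) \<longleftrightarrow> True"
| "positive (Pred q t) \<longleftrightarrow> True"
| "positive (Neg \<phi>) \<longleftrightarrow> False"
| "positive (Conj \<phi> \<psi>) \<longleftrightarrow> positive \<phi> \<and> positive \<psi>"
| "positive (Disj \<phi> \<psi>) \<longleftrightarrow> positive \<phi> \<and> positive \<psi>"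
| "positive (Exi n \<phi>) \<longleftrightarrow> positive \<phi>"
| "positive (Uni n \<phi>) \<longleftrightarrow> positive \<phi>"

text \<open>Constants are elements of the group itself and are interpreted by themselves.\<close>

primrec trm_val :: "('a, 'm) monoid_scheme \<Rightarrow> (nat \<Rightarrow> 'a) \<Rightarrow> 'a trm \<Rightarrow> 'a" where
  "trm_val G e (Var n) = e n"
| "trm_val G e (Const c) = c"
| "trm_val G e One = \<one>\<^bsub>G\<^esub>"
| "trm_val G e (Mult s t) = trm_val G e s \<otimes>\<^bsub>G\<^esub> trm_val G e t"
| "trm_val G e (Inv t) = inv\<^bsub>G\<^esub> (trm_val G e t)"

primrec sat ::
    "('a, 'm) monoid_scheme \<Rightarrow> ('a \<Rightarrow> 'q) \<Rightarrow> (nat \<Rightarrow> 'a) \<Rightarrow> ('a, 'q) fm \<Rightarrow> bool" where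
  "sat G \<pi> e (Eq s t) \<longleftrightarrow> trm_val G e s = trm_val G e t"
| "sat G \<pi> e (Pred q t) \<longleftrightarrow> trm_val G e t \<in> {g \<in> carrier G. \<pi> g = q}"
| "sat G \<pi> e (Neg \<phi>) \<longleftrightarrow> \<not> sat G \<pi> e \<phi>"
| "sat G \<pi> e (Conj \<phi> \<psi>) \<longleftrightarrow> sat G \<pi> e \<phi> \<and> sat G \<pi> e \<psi>"
| "sat G \<pi> e (Disj \<phi> \<psi>) \<longleftrightarrow> sat G \<pi> e \<phi> \<or> sat G \<pi> e \<psi>"
| "sat G \<pi> e (Exi n \<phi>) \<longleftrightarrow> (\<exists>g \<in> carrier G. sat G \<pi> (e(n := g)) \<phi>)"
| "sat G \<pi> e (Uni n \<phi>) \<longleftrightarrow> (\<forall>g \<in> carrier G. sat G \<pi> (e(n := g)) \<phi>)"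

definition LQ_sentences :: "('q, 'n) monoid_scheme \<Rightarrow> 'a set \<Rightarrow> ('a, 'q) fm set" where
  "LQ_sentences Q A =
     {\<phi>. free_vars \<phi> = {} \<and> constants \<phi> \<subseteq> A \<and> predicates \<phi> \<subseteq> carrier Q}"

definition holds :: "('a, 'm) monoid_scheme \<Rightarrow> ('a \<Rightarrow> 'q) \<Rightarrow> ('a, 'q) fm \<Rightarrow> bool" where
  "holds G \<pi> \<phi> \<longleftrightarrow> (\<forall>e. range e \<subseteq> carrier G \<longrightarrow> sat G \<pi> e \<phi>)"

definition positive_theory ::
    "('q, 'n) monoid_scheme \<Rightarrow> 'a set \<Rightarrow> ('a, 'm) monoid_scheme \<Rightarrow> ('a \<Rightarrow> 'q) \<Rightarrow> ('a, 'q) fm set"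
  where
  "positive_theory Q A G \<pi> = {\<phi> \<in> LQ_sentences Q A. positive \<phi> \<and> holds G \<pi> \<phi>}"

end

theory Submission
  imports Defs Complex_Main "HOL-Algebra.Multiplicative_Group"
begin

text \<open>
  By symmetry one inclusion is enough. If a positive sentence holds in \<open>F\<^sub>1\<close>, then it has a formal
  solution: each universal variable can be replaced by a new free generator (one for each value in
  \<open>Q\<close>), and for the existential variables there are words in the basis of \<open>F\<^sub>1\<close> and in the previous new
  generators that make all the equations true in the free group on all these letters and have the
  required values in \<open>Q\<close> (\<open>sat_imp_formally_true\<close>). A formal solution can be evaluated in every
  group over \<open>Q\<close> that receives a homomorphism from \<open>F\<^sub>1\<close> over \<open>Q\<close> fixing \<open>A\<close>
  (\<open>formally_true_sound\<close>). Such a homomorphism to \<open>F\<^sub>2\<close> exists because \<open>F\<^sub>1\<close> is free, \<open>A\<close> is a free factor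
  of it and \<open>\<pi>\<^sub>2\<close> is surjective (\<open>positive_theory_subset\<close>).

  The formal solution comes from Merzlyakov's cancellation argument. A universal variable is given a
  generic value \<open>m\<close>, the product of very many words \<open>w\<^sub>1, \<dots>, w\<^sub>N\<close> (and of a short tail that
  adjusts the value in \<open>Q\<close>) that are long and cannot overlap each other. For each \<open>j\<close> let \<open>\<Phi>\<^sub>j\<close> replace
  every occurrence of \<open>w\<^sub>j\<close> in a reduced word by the word that turns \<open>m\<close> into a new letter. Then \<open>\<Phi>\<^sub>j\<close>
  keeps all short words and preserves values in \<open>Q\<close>, and it respects a product \<open>u v\<close> unless one of the
  three junctions at which \<open>u\<close>, \<open>v\<close> and \<open>u v\<close> are cut by the cancellation lies inside an occurrence of
  \<open>w\<^sub>j\<close>. A junction lies inside an occurrence of at most one of the words, so each product is respected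
  by all but three of the maps (\<open>card_substw_mult_fails\<close>). Therefore, if \<open>N\<close> is large compared with the
  number of multiplications, some \<open>\<Phi>\<^sub>j\<close> respects all of them and transforms the witnesses in \<open>F\<^sub>1\<close> into a
  formal solution.

  With nested quantifiers the choice of \<open>j\<close> for an outer variable depends on the witnesses for inner
  ones. So no choice is made before the end: along the formula one keeps a family of composed maps, of
  which only a small fraction violates a given product, and shows that the transformed witnesses form a
  formal solution for most of the maps (\<open>sat_imp_mostly_formally_true\<close>).
\<close>

section \<open>Free reduction of words\<close>

definition linv :: "bool \<times> 'g \<Rightarrow> bool \<times> 'g" where
  "linv l = (\<not> fst l, snd l)"

definition winv :: "(bool \<times> 'g) list \<Rightarrow> (bool \<times> 'g) list" where
  "winv w = rev (map linv w)"

definition reduced :: "(bool \<times> 'g) list \<Rightarrow> bool" where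
  "reduced w \<longleftrightarrow> successively (\<lambda>k l. l \<noteq> linv k) w"

fun push :: "bool \<times> 'g \<Rightarrow> (bool \<times> 'g) list \<Rightarrow> (bool \<times> 'g) list" where
  "push x [] = [x]"
| "push x (y # ys) = (if y = linv x then ys else x # y # ys)"

definition nf :: "(bool \<times> 'g) list \<Rightarrow> (bool \<times> 'g) list" where
  "nf w = foldr push w []"

abbreviation gens :: "(bool \<times> 'g) list \<Rightarrow> 'g set" where
  "gens w \<equiv> snd ` set w"

lemma linv_linv [simp]: "linv (linv l) = l" and snd_linv [simp]: "snd (linv l) = snd l"
  and fst_linv [simp]: "fst (linv l) \<longleftrightarrow> \<not> fst l"
  by (simp_all add: linv_def)

lemma linv_eq_iff [simp]: "linv k = linv l \<longleftrightarrow> k = l"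
  by (metis linv_linv)

lemma winv_simps [simp]: "winv [] = []" "winv (u @ v) = winv v @ winv u"
  "winv (x # u) = winv u @ [linv x]" "winv (winv u) = u" "length (winv u) = length u"
  "gens (winv u) = gens u"
  by (auto simp: winv_def rev_map comp_def image_image)

lemma winv_eq_iff [simp]: "winv u = winv v \<longleftrightarrow> u = v"
  by (metis winv_simps(4))

lemma winv_eq_Nil [simp]: "winv u = [] \<longleftrightarrow> u = []"
  by (simp add: winv_def)

lemma reduced_words_iff: "w \<in> reduced_words X \<longleftrightarrow> gens w \<subseteq> X \<and> reduced w"
proof -
  have "(snd k = snd l \<longrightarrow> fst k = fst l) \<longleftrightarrow> l \<noteq> linv k" for k l :: "bool \<times> 'a"
    by (cases k; cases l) (auto simp: linv_def)
  then show ?thesis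
    by (simp add: reduced_words_def reduced_def)
qed

lemma reduced_Nil [simp]: "reduced []" and reduced_single [simp]: "reduced [x]"
  by (simp_all add: reduced_def)

lemma reduced_Cons_Cons [simp]: "reduced (x # y # u) \<longleftrightarrow> y \<noteq> linv x \<and> reduced (y # u)"
  by (auto simp: reduced_def)

lemma reduced_append_iff:
  "reduced (u @ v) \<longleftrightarrow> reduced u \<and> reduced v \<and> (u \<noteq> [] \<longrightarrow> v \<noteq> [] \<longrightarrow> hd v \<noteq> linv (last u))"
  by (auto simp: reduced_def successively_append_iff)

lemma reduced_winv [simp]: "reduced (winv u) \<longleftrightarrow> reduced u"
proof -
  have "reduced u \<Longrightarrow> reduced (winv u)" for u :: "(bool \<times> 'g) list"
  proof (induction u)
    case (Cons x u)
    then show ?case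
      by (cases u) (auto simp: reduced_append_iff)
  qed simp
  from this[of u] this[of "winv u"] show ?thesis by auto
qed

lemma reduced_push: "reduced u \<Longrightarrow> reduced (push x u)"
  by (cases "(x, u)" rule: push.cases) (auto simp: reduced_def successively_Cons)

lemma push_push_linv [simp]: "reduced u \<Longrightarrow> push x (push (linv x) u) = u"
  "reduced u \<Longrightarrow> push (linv x) (push x u) = u"
  by (cases u; cases "tl u"; auto)+

lemma nf_Nil [simp]: "nf [] = []" and nf_Cons [simp]: "nf (x # u) = push x (nf u)"
  by (simp_all add: nf_def)

lemma reduced_nf [simp]: "reduced (nf u)"
  by (induction u) (auto intro: reduced_push)

lemma nf_reduced [simp]: "reduced u \<Longrightarrow> nf u = u"
proof (induction u)
  case (Cons x u)
  then show ?case by (cases u) auto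
qed simp

lemma nf_append_nf_right [simp]: "nf (u @ nf v) = nf (u @ v)"
  by (induction u) auto

lemma nf_append_nf_left [simp]: "nf (nf u @ v) = nf (u @ v)"
proof (induction u)
  case (Cons x u)
  show ?case
  proof (cases "nf u")
    case (Cons y t)
    with Cons.IH show ?thesis
      by (cases "y = linv x") (use Cons.IH in \<open>auto simp: Cons.IH[symmetric]\<close>)
  qed (use Cons.IH in auto)
qed simp

lemma nf_cancel [simp]: "nf (q @ winv q @ r) = nf r" "nf (winv q @ q @ r) = nf r"
proof -
  show 1: "nf (q @ winv q @ r) = nf r" for q r :: "(bool \<times> 'g) list"
  proof (induction q arbitrary: r)
    case (Cons x q)
    have "nf ((x # q) @ winv (x # q) @ r) = push x (nf (q @ winv q @ (linv x # r)))"
      by simp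
    also have "\<dots> = nf r" by (simp only: Cons.IH) simp
    finally show ?case .
  qed simp
  from 1[of "winv q"] show "nf (winv q @ q @ r) = nf r" by simp
qed

lemma nf_cancel_Nil [simp]: "nf (q @ winv q) = []" "nf (winv q @ q) = []"
  using nf_cancel[of q "[]"] by simp_all

lemma nf_cancel_mid [simp]: "nf (p @ q @ winv q @ r) = nf (p @ r)"
  by (subst (1 2) nf_append_nf_right[symmetric]) (simp only: nf_cancel)

lemma nf_cong: "nf u = nf u' \<Longrightarrow> nf v = nf v' \<Longrightarrow> nf (u @ v) = nf (u' @ v')"
proof -
  assume *: "nf u = nf u'" "nf v = nf v'"
  have "nf (u @ v) = nf (nf u @ nf v)" by simp
  also have "\<dots> = nf (u' @ v')" by (simp only: * nf_append_nf_left nf_append_nf_right)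
  finally show ?thesis .
qed

lemma gens_push: "gens (push x u) \<subseteq> insert (snd x) (gens u)"
  by (cases u) auto

lemma gens_nf: "gens (nf u) \<subseteq> gens u"
proof (induction u)
  case (Cons x u)
  with gens_push[of x "nf u"] show ?case by auto
qed simp

lemma nf_winv: "nf (winv u) = winv (nf u)"
proof -
  have "nf (winv u) = nf (winv u @ nf (nf u @ winv (nf u)))"
    by (simp only: nf_cancel_Nil append_Nil2)
  also have "\<dots> = nf (winv u @ nf u @ winv (nf u))"
    by (rule nf_append_nf_right)
  also have "\<dots> = nf (winv u @ nf (u @ winv (nf u)))"
    by (intro nf_cong) (simp_all only: nf_append_nf_left nf_reduced reduced_nf)
  also have "\<dots> = nf (winv u @ u @ winv (nf u))"
    by (rule nf_append_nf_right)
  also have "\<dots> = nf (winv (nf u))" by (rule nf_cancel)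
  also have "\<dots> = winv (nf u)" by (rule nf_reduced) simp
  finally show ?thesis .
qed

text \<open>
  In a product of two reduced words everything that cancels is a suffix of the first one and a
  prefix of the second one. Hence only three junctions matter for the product: those between
  \<open>p\<close> and \<open>q\<close>, between \<open>winv q\<close> and \<open>r\<close>, and between \<open>p\<close> and \<open>r\<close>.
\<close>

lemma nf_append_decomp:
  assumes "reduced u" "reduced v"
  obtains p q r where "u = p @ q" "v = winv q @ r" "nf (u @ v) = p @ r"
proof -
  have "\<exists>p q r. u = p @ q \<and> v = winv q @ r \<and> nf (u @ v) = p @ r"
    using assms
  proof (induction u arbitrary: v rule: rev_induct)
    case Nil
    then show ?case by (intro exI[of _ "[]"] exI[of _ v]) auto
  next
    case (snoc x u)
    have ru: "reduced u" using snoc.prems by (simp add: reduced_append_iff)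
    show ?case
    proof (cases "v \<noteq> [] \<and> hd v = linv x")
      case True
      then obtain v' where v: "v = linv x # v'" by (cases v) auto
      with snoc.prems have "reduced v'" by (cases v') auto
      from snoc.IH[OF ru this] obtain p q r
        where *: "u = p @ q" "v' = winv q @ r" "nf (u @ v') = p @ r" by blast
      have "nf ((u @ [x]) @ v) = nf (u @ [x] @ winv [x] @ v')" by (simp add: v)
      also have "\<dots> = p @ r" by (simp only: nf_cancel_mid *(3))
      finally show ?thesis
        using * v by (intro exI[of _ p] exI[of _ "q @ [x]"] exI[of _ r]) auto
    next
      case False
      with snoc.prems have "reduced ((u @ [x]) @ v)"
        by (subst reduced_append_iff) auto
      then show ?thesis by (intro exI[of _ "u @ [x]"] exI[of _ "[]"] exI[of _ v]) auto
    qed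
  qed
  then show ?thesis using that by blast
qed

section \<open>Values of words in groups\<close>

definition wval :: "('a, 'm) monoid_scheme \<Rightarrow> ('g \<Rightarrow> 'a) \<Rightarrow> (bool \<times> 'g) list \<Rightarrow> 'a" where
  "wval G f w = list_prod G (map (letter_val G) (map (map_prod id f) w))"

lemma (in monoid) list_prod_closed: "set gs \<subseteq> carrier G \<Longrightarrow> list_prod G gs \<in> carrier G"
  by (induction gs) (auto simp: list_prod_def)

lemma (in monoid) list_prod_append:
  "set gs \<subseteq> carrier G \<Longrightarrow> set hs \<subseteq> carrier G \<Longrightarrow>
   list_prod G (gs @ hs) = list_prod G gs \<otimes> list_prod G hs"
proof (induction gs)
  case (Cons g gs)
  then have "list_prod G gs \<in> carrier G" "list_prod G hs \<in> carrier G"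
    by (auto intro: list_prod_closed)
  with Cons show ?case by (auto simp: list_prod_def m_assoc)
qed (use list_prod_closed in \<open>auto simp: list_prod_def\<close>)

lemma wval_Nil [simp]: "wval G f [] = \<one>\<^bsub>G\<^esub>"
  by (simp add: wval_def list_prod_def)

lemma wval_Cons: "wval G f (x # w) = letter_val G (fst x, f (snd x)) \<otimes>\<^bsub>G\<^esub> wval G f w"
  by (cases x) (simp add: wval_def list_prod_def)

lemma wval_cong: "(\<And>x. x \<in> gens w \<Longrightarrow> f x = g x) \<Longrightarrow> wval G f w = wval G g w"
  by (induction w) (auto simp: wval_Cons)

context group
begin

lemma letter_val_closed: "snd l \<in> carrier G \<Longrightarrow> letter_val G l \<in> carrier G"
  by (auto simp: letter_val_def)

lemma wval_closed [simp]: "\<forall>x. f x \<in> carrier G \<Longrightarrow> wval G f w \<in> carrier G"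
  by (induction w) (auto simp: wval_Cons intro!: letter_val_closed)

lemma wval_append:
  "\<forall>x. f x \<in> carrier G \<Longrightarrow> wval G f (u @ v) = wval G f u \<otimes> wval G f v"
proof (induction u)
  case (Cons x u)
  have "letter_val G (fst x, f (snd x)) \<in> carrier G"
    using Cons.prems by (intro letter_val_closed) auto
  with Cons show ?case by (simp add: wval_Cons m_assoc)
qed simp

lemma wval_single: "\<forall>x. f x \<in> carrier G \<Longrightarrow> wval G f [(True, x)] = f x"
  by (simp add: wval_Cons letter_val_def)

lemma letter_val_linv:
  "f (snd x) \<in> carrier G \<Longrightarrow>
   letter_val G (fst (linv x), f (snd (linv x))) = inv (letter_val G (fst x, f (snd x)))"
  by (simp add: letter_val_def)

lemma wval_winv: "\<forall>x. f x \<in> carrier G \<Longrightarrow> wval G f (winv u) = inv (wval G f u)"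
proof (induction u)
  case (Cons x u)
  have "f (snd x) \<in> carrier G" using Cons.prems by auto
  moreover from this have "letter_val G (fst x, f (snd x)) \<in> carrier G"
    by (intro letter_val_closed) auto
  ultimately show ?case
    using Cons letter_val_linv[of f x] by (simp add: wval_append wval_Cons inv_mult_group)
qed simp

lemma wval_push: "\<forall>x. f x \<in> carrier G \<Longrightarrow> wval G f (push x u) = wval G f (x # u)"
proof (cases u)
  case (Cons y t)
  assume f: "\<forall>x. f x \<in> carrier G"
  have "wval G f ([x] @ winv [x] @ t) = wval G f t"
    by (simp only: wval_append[OF f] wval_winv[OF f] m_assoc[symmetric] wval_closed[OF f]
        inv_closed r_inv l_one)
  then show ?thesis using Cons by auto
qed simp

lemma wval_nf [simp]: "\<forall>x. f x \<in> carrier G \<Longrightarrow> wval G f (nf u) = wval G f u"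
  by (induction u) (auto simp: wval_push wval_Cons)

end

lemma hom_wval:
  assumes "group G" "group H" "h \<in> hom G H" "\<forall>x. f x \<in> carrier G"
  shows "h (wval G f w) = wval H (h \<circ> f) w"
proof -
  interpret h: group_hom G H h by (simp add: assms group_hom.intro group_hom_axioms.intro)
  show ?thesis
  proof (induction w)
    case (Cons x w)
    have fx: "f (snd x) \<in> carrier G" using assms(4) by auto
    then have "letter_val G (fst x, f (snd x)) \<in> carrier G"
      by (simp add: letter_val_def)
    moreover have "h (letter_val G (fst x, f (snd x))) = letter_val H (fst x, h (f (snd x)))"
      using fx by (simp add: letter_val_def)
    ultimately show ?case using Cons assms(4) by (simp add: wval_Cons)
  qed simp
qed

section \<open>Replacing the occurrences of a word\<close>

text \<open>
  The occurrences of \<open>w\<close> and of its inverse are found greedily from left to right. When \<open>w\<close> cannot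
  overlap itself, as below, the choice of the direction makes no difference.
\<close>

fun repl :: "(bool \<times> 'g) list \<Rightarrow> (bool \<times> 'g) list \<Rightarrow> (bool \<times> 'g) list \<Rightarrow> (bool \<times> 'g) list" where
  "repl w r [] = []"
| "repl w r (x # u) =
     (if w \<noteq> [] \<and> take (length w) (x # u) = w then r @ repl w r (drop (length w - 1) u)
      else if w \<noteq> [] \<and> take (length w) (x # u) = winv w then winv r @ repl w r (drop (length w - 1) u)
      else x # repl w r u)"

text \<open>
  Replacing commutes with concatenation unless an occurrence of \<open>w\<close> or of its inverse has the
  junction of the two words in its interior. All failures of multiplicativity come from this.
\<close>

definition straddles :: "(bool \<times> 'g) list \<Rightarrow> (bool \<times> 'g) list \<Rightarrow> (bool \<times> 'g) list \<Rightarrow> bool" where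
  "straddles w u v \<longleftrightarrow> (\<exists>u' p s v'. u = u' @ p \<and> v = s @ v' \<and> p \<noteq> [] \<and> s \<noteq> [] \<and>
     (p @ s = w \<or> p @ s = winv w))"

lemma repl_prefix: "w \<noteq> [] \<Longrightarrow> repl w r (w @ u) = r @ repl w r u"
  by (cases w) auto

lemma repl_append:
  assumes "\<not> straddles w u v"
  shows "repl w r (u @ v) = repl w r u @ repl w r v"
  using assms
proof (induction u rule: length_induct)
  case (1 u)
  show ?case
  proof (cases u)
    case (Cons x u1)
    have dr: "\<not> straddles w (drop k u) v" for k
      using 1(2) unfolding straddles_def by (metis append.assoc append_take_drop_id)
    have IH: "repl w r (drop k u1 @ v) = repl w r (drop k u1) @ repl w r v" for k
      using 1(1)[rule_format, OF _ dr[of "Suc k"]] Cons by auto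
    have eq: "take (length w) (u @ v) = y \<longleftrightarrow> take (length w) u = y"
      if "w \<noteq> []" and y: "y = w \<or> y = winv w" for y
    proof (cases "length w \<le> length u")
      case False
      have ly: "length y = length w" using y by auto
      have "take (length w) (u @ v) \<noteq> y"
      proof
        assume *: "take (length w) (u @ v) = y"
        with False have "y = u @ take (length w - length u) v" by simp
        moreover from this False ly have "take (length w - length u) v \<noteq> []" by auto
        ultimately have "straddles w u v"
          unfolding straddles_def using y Cons
          by (intro exI[of _ "[]"] exI[of _ u] exI[of _ "take (length w - length u) v"]
              exI[of _ "drop (length w - length u) v"]) auto
        with 1(2) show False by blast
      qed
      moreover have "take (length w) u \<noteq> y" using False ly by auto
      ultimately show ?thesis by blast
    qed simp
    have step: "repl w r (y # t) =
        (if w \<noteq> [] \<and> take (length w) (y # t) = w then r @ repl w r (drop (length w - 1) t)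
         else if w \<noteq> [] \<and> take (length w) (y # t) = winv w
           then winv r @ repl w r (drop (length w - 1) t)
         else y # repl w r t)" for y t
      by (rule repl.simps)
    show ?thesis
    proof (cases "w \<noteq> [] \<and> (take (length w) u = w \<or> take (length w) u = winv w)")
      case True
      then have "length w \<le> length u"
        by (metis length_take min.cobounded1 min.absorb_iff2 winv_simps(5))
      then have d: "drop (length w - 1) (u1 @ v) = drop (length w - 1) u1 @ v"
        using Cons True by (cases w) auto
      show ?thesis
        using True eq[of w] eq[of "winv w"] unfolding Cons append_Cons step d
        by (auto simp: IH simp del: repl.simps)
    next
      case False
      then show ?thesis
        using eq[of w] eq[of "winv w"] IH[of 0] unfolding Cons append_Cons step by auto
    qed
  qed simp
qed


lemma repl_short: "length u < length w \<Longrightarrow> repl w r u = u"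
proof (induction u)
  case (Cons x u)
  have "length (take (length w) (x # u)) < length w" using Cons.prems by simp
  then have "take (length w) (x # u) \<noteq> w" "take (length w) (x # u) \<noteq> winv w"
    by (metis nat_neq_iff, metis nat_neq_iff winv_simps(5))
  with Cons show ?case by simp
qed simp

lemma repl_same_length:
  "length u = length w \<Longrightarrow> u \<noteq> w \<Longrightarrow> u \<noteq> winv w \<Longrightarrow> repl w r u = u"
  by (cases u) (auto simp: repl_short)

lemma repl_prefix_winv:
  assumes "w \<noteq> []" "winv w \<noteq> w"
  shows "repl w r (winv w @ u) = winv r @ repl w r u"
proof (cases "winv w")
  case (Cons x t)
  have l: "length w = Suc (length t)" using Cons by (metis length_Cons winv_simps(5))
  then have "take (length w) (x # t @ u) = x # t" "drop (length w - 1) (t @ u) = u" by simp_all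
  then show ?thesis using assms Cons by simp
qed (use assms in auto)

lemma repl_skip:
  "take (length w) (x # u) \<noteq> w \<Longrightarrow> take (length w) (x # u) \<noteq> winv w \<Longrightarrow>
   repl w r (x # u) = x # repl w r u"
  by simp

lemma repl_induct [consumes 1, case_names Nil prefix prefix_winv skip]:
  assumes w: "w \<noteq> []"
    and "P []" "\<And>u. P u \<Longrightarrow> P (w @ u)" "\<And>u. winv w \<noteq> w \<Longrightarrow> P u \<Longrightarrow> P (winv w @ u)"
    and "\<And>x u. take (length w) (x # u) \<noteq> w \<Longrightarrow> take (length w) (x # u) \<noteq> winv w \<Longrightarrow> P u \<Longrightarrow>
      P (x # u)"
  shows "P u"
proof (induction u rule: length_induct)
  case (1 u)
  define t where "t = drop (length w) u"
  have u: "u = take (length w) u @ t" by (simp add: t_def)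
  have IH: "P t" if "u \<noteq> []" using 1 w that by (simp add: t_def)
  consider "u = []" | "u \<noteq> []" "take (length w) u = w"
    | "u \<noteq> []" "take (length w) u = winv w" "winv w \<noteq> w"
    | x v where "u = x # v" "take (length w) u \<noteq> w" "take (length w) u \<noteq> winv w"
    by (metis neq_Nil_conv)
  then show ?case
  proof cases
    case 1
    then show ?thesis using assms(2) by simp
  next
    case 2
    then show ?thesis using u IH assms(3)[of t] by simp
  next
    case 3
    then show ?thesis using u IH assms(4)[of t] by simp
  next
    case 4
    then show ?thesis using 1 assms(5)[of x v] by simp
  qed
qed

lemma gens_repl:
  assumes "w \<noteq> []"
  shows "gens (repl w r u) \<subseteq> gens u \<union> gens r"
  using assms
proof (induction u rule: repl_induct)
  case (prefix u)
  then show ?case using assms by (auto simp: repl_prefix)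
next
  case (prefix_winv u)
  then have "gens (repl w r (winv w @ u)) = gens r \<union> gens (repl w r u)"
    using assms winv_simps(6)[of r] by (simp add: repl_prefix_winv image_Un)
  with prefix_winv show ?case by auto
next
  case (skip x u)
  then show ?case by (subst repl_skip) auto
qed simp

lemma (in group) wval_repl:
  assumes f: "\<forall>x. f x \<in> carrier G" and wr: "wval G f r = wval G f w" and w: "w \<noteq> []"
  shows "wval G f (repl w r u) = wval G f u"
  using w
proof (induction u rule: repl_induct)
  case (skip x u)
  then show ?case by (subst repl_skip) (auto simp: wval_Cons)
qed (simp_all add: w wr f repl_prefix repl_prefix_winv wval_append wval_winv)

text \<open>
  Words of one length in positive letters such that a non-empty suffix of one of them can be a
  prefix of another one, or of the same one, only if it is the whole word. Positivity keeps
  occurrences of these words apart from occurrences of their inverses.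
\<close>

definition nonoverlapping :: "nat \<Rightarrow> (bool \<times> 'g) list set \<Rightarrow> bool" where
  "nonoverlapping L W \<longleftrightarrow> 0 < L \<and> (\<forall>w \<in> W. length w = L \<and> (\<forall>l \<in> set w. fst l)) \<and>
     (\<forall>w \<in> W. \<forall>w' \<in> W. \<forall>x t y. w = x @ t \<longrightarrow> w' = t @ y \<longrightarrow> t \<noteq> [] \<longrightarrow> x = [])"

lemma nonoverlappingD:
  assumes "nonoverlapping L W" "w \<in> W"
  shows "length w = L" "w \<noteq> []" "l \<in> set w \<Longrightarrow> fst l" "l \<in> set (winv w) \<Longrightarrow> \<not> fst l"
    "w' \<in> W \<Longrightarrow> w = x @ t \<Longrightarrow> w' = t @ y \<Longrightarrow> t \<noteq> [] \<Longrightarrow> x = []"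
proof -
  show "length w = L" and p: "l \<in> set w \<Longrightarrow> fst l" for l
    using assms by (auto simp: nonoverlapping_def)
  show "w \<noteq> []"
    using assms by (auto simp: nonoverlapping_def)
  show "l \<in> set (winv w) \<Longrightarrow> \<not> fst l"
    using p by (auto simp: winv_def)
  show "w' \<in> W \<Longrightarrow> w = x @ t \<Longrightarrow> w' = t @ y \<Longrightarrow> t \<noteq> [] \<Longrightarrow> x = []"
    using assms unfolding nonoverlapping_def by blast
qed

text \<open>
  Two occurrences that contain the same junction in their interior share the letter before it, so
  they have the same sign, and then the non-empty common part is a suffix of one word and a prefix of
  the other one. So each junction disturbs the replacement of at most one of the words.
\<close>

lemma straddles_unique:
  assumes W: "nonoverlapping L W" and w: "w \<in> W" "w' \<in> W"
    and s: "straddles w u v" "straddles w' u v"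
  shows "w = w'"
proof -
  have aux: "w = w'"
    if w: "w \<in> W" "w' \<in> W"
      and u: "u = u1 @ p" "u = u2 @ p'" and v: "v = s @ v1" "v = s' @ v2"
      and ne: "p \<noteq> []" "s \<noteq> []" "p' \<noteq> []" "s' \<noteq> []"
      and ps: "p @ s = w \<or> p @ s = winv w" "p' @ s' = w' \<or> p' @ s' = winv w'"
      and le: "length p \<le> length p'" for w w' u1 u2 v1 v2 p p' s s'
  proof -
    note D = nonoverlappingD[OF W]
    have len: "length p + length s = L" "length p' + length s' = L"
      using ps D(1) w by (metis length_append winv_simps(5))+
    with le have le': "length s' \<le> length s" by linarith
    obtain d where d: "p' = d @ p"
    proof -
      from u have "u1 @ p = u2 @ p'" by simp
      then obtain z where "u1 = u2 @ z \<and> z @ p = p' \<or> u1 @ z = u2 \<and> p = z @ p'"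
        by (auto simp: append_eq_append_conv2)
      with le that show ?thesis by auto
    qed
    obtain e where e: "s = s' @ e"
    proof -
      from v have "s @ v1 = s' @ v2" by simp
      then obtain z where "s = s' @ z \<and> z @ v1 = v2 \<or> s @ z = s' \<and> v1 = z @ v2"
        by (auto simp: append_eq_append_conv2)
      with le' that show ?thesis by auto
    qed
    have lw: "last p \<in> set (p @ s)" "last p \<in> set (p' @ s')"
      using ne by (auto simp: d)
    show "w = w'"
    proof (cases "p @ s = w")
      case True
      then have "fst (last p)" using lw D(3) w by blast
      then have "p' @ s' = w'" using ps(2) lw(2) D(4)[OF w(2), of "last p"] by metis
      then have w': "w' = d @ (p @ s')" using d by simp
      have "w = (p @ s') @ e" using True e by simp
      then have "d = []" using D(5)[OF w(2,1) w'] ne by blast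
      then show ?thesis using w' True len d e by auto
    next
      case False
      then have pw: "p @ s = winv w" using ps by blast
      then have "\<not> fst (last p)" using lw(1) D(4)[OF w(1), of "last p"] by simp
      then have "p' @ s' = winv w'" using ps(2) lw(2) D(3)[OF w(2), of "last p"] by metis
      then have w': "w' = winv (p @ s') @ winv d" 
        using d by (metis append.assoc winv_simps(2,4))
      have w2: "w = winv e @ winv (p @ s')" using pw e by (metis append.assoc winv_simps(2,4))
      have "winv e = []" using D(5)[OF w w2 w'] ne by auto
      then show ?thesis using w' w2 len d e by auto
    qed
  qed
  obtain u1 p s v1 where 1: "u = u1 @ p" "v = s @ v1" "p \<noteq> []" "s \<noteq> []"
      "p @ s = w \<or> p @ s = winv w"
    using s(1) unfolding straddles_def by blast
  obtain u2 p' s' v2 where 2: "u = u2 @ p'" "v = s' @ v2" "p' \<noteq> []" "s' \<noteq> []"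
      "p' @ s' = w' \<or> p' @ s' = winv w'"
    using s(2) unfolding straddles_def by blast
  show ?thesis
  proof (cases "length p \<le> length p'")
    case True
    show ?thesis by (rule aux[OF w 1(1) 2(1) 1(2) 2(2) 1(3,4) 2(3,4) 1(5) 2(5) True])
  next
    case False
    have "w' = w"
      by (rule aux[OF w(2,1) 2(1) 1(1) 2(2) 1(2) 2(3,4) 1(3,4) 2(5) 1(5)]) (use False in simp)
    then show ?thesis by simp
  qed
qed

text \<open>
  Scanning the inverse of a word is scanning the word from right to left. As \<open>w\<close> cannot overlap
  itself, this finds the same occurrences.
\<close>

lemma repl_winv:
  assumes W: "nonoverlapping L W" "w \<in> W"
  shows "repl w r (winv u) = winv (repl w r u)"
proof -
  note D = nonoverlappingD[OF W]
  have ww: "winv w \<noteq> w"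
    using D(2,3,4) by (metis hd_in_set)
  have r1: "repl w r w = r" "repl w r (winv w) = winv r"
    using repl_prefix[OF D(2), of r "[]"] repl_prefix_winv[OF D(2) ww, of r "[]"] by simp_all
  have ns: "\<not> straddles w z y" if y: "y = w \<or> y = winv w" for z y
  proof
    assume "straddles w z y"
    then obtain u' p s v' where *: "z = u' @ p" "y = s @ v'" "p \<noteq> []" "s \<noteq> []"
      "p @ s = w \<or> p @ s = winv w" unfolding straddles_def by blast
    have "hd s \<in> set (p @ s)" and sy: "hd s \<in> set y" using * by auto
    then have pos: "fst (hd s) \<Longrightarrow> p @ s = w" and neg: "\<not> fst (hd s) \<Longrightarrow> p @ s = winv w"
      using *(5) D(3)[of "hd s"] D(4)[of "hd s"] by (metis, metis)
    from y show False
    proof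
      assume y: "y = w"
      then have "p @ s = w" using pos sy D(3) by blast
      moreover have "w = s @ v'" using * y by simp
      ultimately have "p = []" using D(5)[OF W(2), of p s v'] *(4) by blast
      with * show False by blast
    next
      assume y: "y = winv w"
      then have "p @ s = winv w" using neg sy D(4) by blast
      then have w1: "w = winv s @ winv p" by (metis winv_simps(2,4))
      have w2: "w = winv v' @ winv s" using y * by (metis winv_simps(2,4))
      have "winv v' = []" using D(5)[OF W(2) w2 w1] * by auto
      with w1 w2 * show False by simp
    qed
  qed
  have ra: "repl w r (z @ y) = repl w r z @ repl w r y" if "y = w \<or> y = winv w" for z y
    by (rule repl_append[OF ns[OF that]])
  show ?thesis
    using D(2)
  proof (induction u rule: repl_induct)
    case (prefix u)
    then show ?case by (simp add: ra r1 repl_prefix[OF D(2)])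
  next
    case (prefix_winv u)
    then show ?case by (simp add: ra r1 repl_prefix_winv[OF D(2) ww])
  next
    case (skip x u)
    have "\<not> straddles w (winv u) [linv x]"
    proof
      assume "straddles w (winv u) [linv x]"
      then obtain u' p where *: "winv u = u' @ p" "p @ [linv x] = w \<or> p @ [linv x] = winv w"
        unfolding straddles_def by (auto simp: Cons_eq_append_conv)
      have "winv (x # u) = u' @ (p @ [linv x])" using * by simp
      then have xu: "x # u = winv (p @ [linv x]) @ winv u'" by (metis winv_simps(2,4))
      have "length (winv (p @ [linv x])) = length w" using *(2) by (metis winv_simps(5))
      then have "take (length w) (x # u) = winv (p @ [linv x])" 
        by (simp only: xu) (metis append_eq_conv_conj)
      then show False using skip *(2) by (metis winv_simps(4))
    qed
    moreover have "repl w r [linv x] = [linv x]"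
    proof (cases "length w = 1")
      case True
      with D(2) obtain a where a: "w = [a]" by (cases w) auto
      show ?thesis using skip by (auto simp: a)
    next
      case False
      with D(2) have "length [linv x] < length w" by (cases w) auto
      then show ?thesis by (rule repl_short)
    qed
    ultimately show ?case
      using repl_append[of w "winv u" "[linv x]" r] skip by (subst repl_skip) auto
  qed simp
qed

text \<open>
  A word of \<open>W\<close> that begins a concatenation is not cut by any occurrence of \<open>w\<close> that runs into the
  rest, whatever the rest is.
\<close>

lemma repl_concat:
  assumes W: "nonoverlapping L W" "w \<in> W" and "set ws \<subseteq> W"
  shows "repl w r (concat ws @ s) = concat (map (\<lambda>w'. if w' = w then r else w') ws) @ repl w r s"
  using assms(3)
proof (induction ws)
  case (Cons w' ws)
  then have w': "w' \<in> W" by simp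
  note D = nonoverlappingD[OF W] and D' = nonoverlappingD[OF W(1) w']
  have "\<not> straddles w w' (concat ws @ s)"
  proof
    assume "straddles w w' (concat ws @ s)"
    then obtain u' p t where *: "w' = u' @ p" "p \<noteq> []" "t \<noteq> []" "p @ t = w \<or> p @ t = winv w"
      unfolding straddles_def by blast
    have "hd p \<in> set w'" "hd p \<in> set (p @ t)" using * by auto
    then have "p @ t = w" using D(4) D'(3) *(4) by metis
    then have "u' = []" using D'(5)[OF W(2) *(1)] * by auto
    then show False using * \<open>p @ t = w\<close> D(1) D'(1) by auto
  qed
  moreover have "repl w r w' = (if w' = w then r else w')"
  proof (cases "w' = w")
    case True
    then show ?thesis using repl_prefix[OF D(2), of r "[]"] by simp
  next
    case False
    moreover have "w' \<noteq> winv w" using D(4) D'(2,3) by (metis hd_in_set)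
    ultimately show ?thesis using D(1) D'(1) by (simp add: repl_same_length)
  qed
  ultimately show ?case using Cons repl_append[of w w' "concat ws @ s" r] by auto
qed simp

definition substw :: "(bool \<times> 'g) list \<Rightarrow> (bool \<times> 'g) list \<Rightarrow> (bool \<times> 'g) list \<Rightarrow> (bool \<times> 'g) list" where
  "substw w r u = nf (repl w r u)"

lemma substw_mult:
  assumes W: "nonoverlapping L W" "w \<in> W"
    and ns: "\<not> straddles w p q" "\<not> straddles w (winv q) t" "\<not> straddles w p t"
  shows "nf (substw w r (p @ q) @ substw w r (winv q @ t)) = substw w r (p @ t)"
proof -
  have "nf (substw w r (p @ q) @ substw w r (winv q @ t))
      = nf (repl w r (p @ q) @ repl w r (winv q @ t))"
    by (simp add: substw_def)
  also have "\<dots> = nf (repl w r p @ repl w r q @ winv (repl w r q) @ repl w r t)"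
    by (simp add: repl_append[OF ns(1)] repl_append[OF ns(2)] repl_winv[OF W])
  also have "\<dots> = substw w r (p @ t)"
    by (simp only: nf_cancel_mid substw_def repl_append[OF ns(3)])
  finally show ?thesis .
qed

lemma card_le_1I: "(\<And>x y. x \<in> S \<Longrightarrow> y \<in> S \<Longrightarrow> x = y) \<Longrightarrow> card S \<le> 1"
  by (metis One_nat_def card_le_Suc0_iff_eq card.infinite le0)

text \<open>
  The key estimate: the bound does not depend on the number of the words \<open>w j\<close>. For a large
  set \<open>J\<close> almost all of the maps \<open>substw (w j) (r j)\<close> respect a given product.
\<close>

lemma card_substw_mult_fails:
  assumes W: "nonoverlapping L (w ` J)" "inj_on w J" "finite J"
    and u: "reduced u" and v: "reduced v"
  shows "card {j \<in> J. substw (w j) (r j) (nf (u @ v)) \<noteq>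
    nf (substw (w j) (r j) u @ substw (w j) (r j) v)} \<le> 3"
proof -
  obtain p q t where d: "u = p @ q" "v = winv q @ t" "nf (u @ v) = p @ t"
    using nf_append_decomp[OF u v] .
  have pt: "nf (p @ t) = p @ t" by (metis d(3) nf_reduced reduced_nf)
  define B where "B y z = {j \<in> J. straddles (w j) y z}" for y z
  have B: "card (B y z) \<le> 1" for y z
    using straddles_unique[OF W(1)] W(2) by (intro card_le_1I) (auto simp: B_def inj_on_def)
  have "{j \<in> J. substw (w j) (r j) (nf (u @ v)) \<noteq>
      nf (substw (w j) (r j) u @ substw (w j) (r j) v)} \<subseteq> B p q \<union> (B (winv q) t \<union> B p t)"
    using substw_mult[OF W(1)] by (fastforce simp: B_def d(1,2) pt)
  then have "card {j \<in> J. substw (w j) (r j) (nf (u @ v)) \<noteq>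
      nf (substw (w j) (r j) u @ substw (w j) (r j) v)} \<le> card (B p q \<union> (B (winv q) t \<union> B p t))"
    using W(3) by (intro card_mono) (auto simp: B_def)
  also have "\<dots> \<le> card (B p q) + (card (B (winv q) t) + card (B p t))"
    by (metis (no_types) add_left_mono card_Un_le order_trans)
  also have "\<dots> \<le> 3" using B[of p q] B[of "winv q" t] B[of p t] by linarith
  finally show ?thesis .
qed

lemma reduced_positive: "\<forall>l \<in> set w. fst l \<Longrightarrow> reduced w"
proof (induction w)
  case (Cons x w)
  then show ?case by (cases w) (auto simp: linv_def)
qed simp

section \<open>Many words without overlaps\<close>

text \<open>
  This is the word \<open>a\<^sup>P b\<^sup>j\<^sup>+\<^sup>1 a b\<^sup>N\<^sup>-\<^sup>j\<close>. If \<open>2 \<le> P\<close>, then it starts with \<open>a\<^sup>P\<close>,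
  ends in \<open>b\<close> and contains \<open>a\<^sup>P\<close> only at its start, so it can overlap another such word only
  completely.
\<close>

definition piece :: "'g \<Rightarrow> 'g \<Rightarrow> nat \<Rightarrow> nat \<Rightarrow> nat \<Rightarrow> (bool \<times> 'g) list" where
  "piece a b P N j = map (\<lambda>k. (True, if k < P \<or> k = P + j + 1 then a else b)) [0..<P + N + 2]"

lemma length_piece [simp]: "length (piece a b P N j) = P + N + 2"
  by (simp add: piece_def)

lemma nth_piece:
  "k < P + N + 2 \<Longrightarrow> piece a b P N j ! k = (True, if k < P \<or> k = P + j + 1 then a else b)"
  by (simp add: piece_def del: upt_Suc)

lemma piece_nth_eq_iff:
  assumes "a \<noteq> b" "k < P + N + 2" "k' < P + N + 2"
  shows "piece a b P N j ! k = piece a b P N j' ! k' \<longleftrightarrow>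
    (k < P \<or> k = P + j + 1 \<longleftrightarrow> k' < P \<or> k' = P + j' + 1)"
  using assms by (auto simp: nth_piece)

lemma inj_on_piece: "a \<noteq> b \<Longrightarrow> inj_on (piece a b P N) {..<N}"
proof (rule inj_onI)
  fix i j assume "a \<noteq> b" "i \<in> {..<N}" "j \<in> {..<N}" "piece a b P N i = piece a b P N j"
  then show "i = j" using piece_nth_eq_iff[of a b "P + i + 1" P N "P + i + 1" i j] by auto
qed

lemma piece_positive: "l \<in> set (piece a b P N j) \<Longrightarrow> fst l"
  by (auto simp: piece_def)

lemma nonoverlapping_pieces:
  assumes ab: "a \<noteq> b" and P: "2 \<le> P"
  shows "nonoverlapping (P + N + 2) (piece a b P N ` {..<N})"
proof -
  have no: "x = []"
    if ij: "i < N" "j < N" and i: "piece a b P N i = x @ t" and j: "piece a b P N j = t @ y"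
      and t: "t \<noteq> []" for i j x t y
  proof -
  define d where "d = length x"
  have l: "d + length t = P + N + 2" using i by (metis d_def length_append length_piece)
  have eq: "(d + k < P \<or> d + k = P + i + 1) \<longleftrightarrow> (k < P \<or> k = P + j + 1)" if "k < length t" for k
  proof -
    have "piece a b P N i ! (d + k) = piece a b P N j ! k"
      using i j that by (simp add: d_def nth_append)
    then show ?thesis
      using piece_nth_eq_iff[OF ab, of "d + k" P N k i j] l that by linarith
  qed
  have "d = 0"
  proof (rule ccontr)
    assume d: "d \<noteq> 0"
    \<comment> \<open>The prefix \<open>a\<^sup>P\<close> of the second word would begin at position \<open>d\<close> of the first one: there
      the run of letters \<open>a\<close> is too short, in the initial block as well as at the later single \<open>a\<close>.\<close>
    from eq[of 0] P t have "d < P \<or> d = P + i + 1" by simp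
    then show False
    proof
      assume "d < P"
      moreover from this l have "P - d < length t" by arith
      ultimately show False using eq[of "P - d"] d by simp
    next
      assume "d = P + i + 1"
      with eq[of 1] l ij P show False by simp
    qed
  qed
  then show "x = []" by (simp add: d_def)
  qed
  show ?thesis
    unfolding nonoverlapping_def
    by (intro conjI ballI allI impI) (auto dest: piece_positive, metis no)
qed

lemma last_piece: "j < N \<Longrightarrow> last (piece a b P N j) = (True, b)"
proof -
  assume "j < N"
  have "piece a b P N j \<noteq> []" by (metis length_piece list.size(3) add_is_0 zero_neq_numeral)
  then have "last (piece a b P N j) = piece a b P N j ! (P + N + 1)" by (simp add: last_conv_nth)
  with \<open>j < N\<close> show ?thesis by (simp add: nth_piece)
qed

definition long_word :: "'g \<Rightarrow> 'g \<Rightarrow> nat \<Rightarrow> nat \<Rightarrow> (bool \<times> 'g) list \<Rightarrow> (bool \<times> 'g) list" where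
  "long_word a b P N s = concat (map (piece a b P N) [0..<N]) @ s"

text \<open>
  The word by which the piece with index \<open>j\<close> has to be replaced in order that the long word becomes
  the single letter \<open>z\<close>. Solving for the piece in this way also makes the replacement compatible with
  every evaluation that gives \<open>z\<close> the value of the long word.
\<close>

definition piece_replacement ::
    "'g \<Rightarrow> 'g \<Rightarrow> nat \<Rightarrow> nat \<Rightarrow> (bool \<times> 'g) list \<Rightarrow> 'g \<Rightarrow> nat \<Rightarrow> (bool \<times> 'g) list" where
  "piece_replacement a b P N s z j = winv (concat (map (piece a b P N) [0..<j])) @ [(True, z)] @
     winv (concat (map (piece a b P N) [Suc j..<N]) @ s)"

lemma upt_split: "j < N \<Longrightarrow> [0..<N] = [0..<j] @ j # [Suc j..<N]"
  using upt_add_eq_append[of 0 j "N - j"] upt_conv_Cons[of j N] by simp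

lemma long_word_split:
  assumes "j < N"
  shows "long_word a b P N s = concat (map (piece a b P N) [0..<j]) @ piece a b P N j @
    (concat (map (piece a b P N) [Suc j..<N]) @ s)"
proof -
  have "[0..<N] = [0..<j] @ j # [Suc j..<N]"
    using upt_split[OF assms] .
  then show ?thesis by (simp add: long_word_def)
qed

lemma reduced_long_word:
  assumes N: "0 < N" and s: "reduced s" "s \<noteq> [] \<Longrightarrow> hd s \<noteq> (False, b)"
  shows "reduced (long_word a b P N s)"
proof -
  obtain N' where N': "N = Suc N'" using N by (cases N) auto
  let ?c = "concat (map (piece a b P N) [0..<N])"
  have ne: "piece a b P N N' \<noteq> []" by (metis length_piece list.size(3) add_is_0 zero_neq_numeral)
  then have "last ?c = (True, b)" using last_piece[of N' N a b P] by (simp add: N')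
  moreover have "reduced ?c" by (rule reduced_positive) (auto dest: piece_positive)
  ultimately show ?thesis
    using s by (auto simp: long_word_def reduced_append_iff linv_def)
qed

lemma substw_long_word:
  assumes ab: "a \<noteq> b" and P: "2 \<le> P" and j: "j < N" and s: "length s < P + N + 2"
  shows "substw (piece a b P N j) (piece_replacement a b P N s z j) (long_word a b P N s) = [(True, z)]"
proof -
  let ?w = "piece a b P N" and ?r = "piece_replacement a b P N s z j"
  note W = nonoverlapping_pieces[OF ab P, of N]
  have same: "map (\<lambda>w'. if w' = ?w j then ?r else w') (map ?w ks) = map ?w ks"
    if "set ks \<subseteq> {..<N} - {j}" for ks
    using that inj_on_piece[OF ab, of P N] j by (auto simp: inj_on_def)
  have sj: "[0..<N] = [0..<j] @ j # [Suc j..<N]"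
    using upt_split[OF j] .
  have "repl (?w j) ?r (long_word a b P N s)
      = concat (map (\<lambda>w'. if w' = ?w j then ?r else w') (map ?w [0..<N])) @ repl (?w j) ?r s"
    unfolding long_word_def by (rule repl_concat[OF W]) (use j in auto)
  also have "repl (?w j) ?r s = s" by (rule repl_short) (use s in simp)
  also have "map (\<lambda>w'. if w' = ?w j then ?r else w') (map ?w [0..<N])
      = map ?w [0..<j] @ ?r # map ?w [Suc j..<N]"
  proof -
    have "set [0..<j] \<subseteq> {..<N} - {j}" "set [Suc j..<N] \<subseteq> {..<N} - {j}" using j by auto
    from same[OF this(1)] same[OF this(2)] show ?thesis
      unfolding sj by (simp only: map_append list.map) simp
  qed
  finally have "substw (?w j) ?r (long_word a b P N s)
      = nf (concat (map ?w [0..<j]) @ ?r @ (concat (map ?w [Suc j..<N]) @ s))"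
    by (simp add: substw_def)
  also have "\<dots> = nf ([(True, z)] @ winv (concat (map ?w [Suc j..<N]) @ s) @
      (concat (map ?w [Suc j..<N]) @ s))"
    unfolding piece_replacement_def by (simp only: append.assoc nf_cancel)
  also have "\<dots> = nf ([(True, z)] @ nf (winv (concat (map ?w [Suc j..<N]) @ s) @
      (concat (map ?w [Suc j..<N]) @ s)))"
    by (simp only: nf_append_nf_right)
  also have "\<dots> = [(True, z)]"
    by (simp only: nf_cancel_Nil) simp
  finally show ?thesis .
qed

lemma (in group) wval_piece_replacement:
  assumes f: "\<forall>x. f x \<in> carrier G" and j: "j < N"
    and z: "f z = wval G f (long_word a b P N s)"
  shows "wval G f (piece_replacement a b P N s z j) = wval G f (piece a b P N j)"
proof -
  let ?p = "concat (map (piece a b P N) [0..<j])"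
    and ?t = "concat (map (piece a b P N) [Suc j..<N]) @ s"
  have c: "wval G f u \<in> carrier G" for u using f by simp
  have "wval G f (piece_replacement a b P N s z j) = inv (wval G f ?p) \<otimes> f z \<otimes> inv (wval G f ?t)"
    unfolding piece_replacement_def by (simp only: wval_append[OF f] wval_winv[OF f] wval_single[OF f] m_assoc
        c inv_closed m_closed f[rule_format])
  also have "f z = wval G f ?p \<otimes> wval G f (piece a b P N j) \<otimes> wval G f ?t"
    unfolding z long_word_split[OF j] by (simp only: wval_append[OF f] m_assoc c m_closed)
  also have "inv (wval G f ?p) \<otimes> (wval G f ?p \<otimes> wval G f (piece a b P N j) \<otimes> wval G f ?t) \<otimes>
      inv (wval G f ?t) = wval G f (piece a b P N j)"
    using c[of ?p] c[of ?t] c[of "piece a b P N j"]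
    by (simp add: m_assoc r_inv) (simp add: m_assoc[symmetric])
  finally show ?thesis .
qed

section \<open>Formal truth\<close>

primrec fval :: "('c \<Rightarrow> (bool \<times> 'g) list) \<Rightarrow> (nat \<Rightarrow> (bool \<times> 'g) list) \<Rightarrow> 'c trm \<Rightarrow> (bool \<times> 'g) list"
  where
  "fval \<kappa> e (Var n) = e n"
| "fval \<kappa> e (Const c) = \<kappa> c"
| "fval \<kappa> e One = []"
| "fval \<kappa> e (Mult s t) = nf (fval \<kappa> e s @ fval \<kappa> e t)"
| "fval \<kappa> e (Inv t) = winv (fval \<kappa> e t)"

definition below :: "nat \<Rightarrow> (bool \<times> ('a + nat)) list \<Rightarrow> bool" where
  "below n u \<longleftrightarrow> (\<forall>k. Inr k \<in> gens u \<longrightarrow> k < n)"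

text \<open>
  Truth with solutions in a free group that does not depend on the values of the universal variables:
  a universally quantified variable stands for a new free generator, one for each value that it may
  have in \<open>Q\<close>, and an existentially quantified one for a word in the generators introduced so far.
  The map \<open>\<tau>\<close> gives the values of the generators in \<open>Q\<close>.
\<close>

primrec formally_true :: "('q, 'n) monoid_scheme \<Rightarrow> ('c \<Rightarrow> (bool \<times> ('a + nat)) list) \<Rightarrow>
    ('c, 'q) fm \<Rightarrow> nat \<Rightarrow> ('a + nat \<Rightarrow> 'q) \<Rightarrow> (nat \<Rightarrow> (bool \<times> ('a + nat)) list) \<Rightarrow> bool"
  where
  "formally_true Q \<kappa> (Eq s t) n \<tau> e \<longleftrightarrow> fval \<kappa> e s = fval \<kappa> e t"
| "formally_true Q \<kappa> (Pred q t) n \<tau> e \<longleftrightarrow> wval Q \<tau> (fval \<kappa> e t) = q"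
| "formally_true Q \<kappa> (Neg \<phi>) n \<tau> e \<longleftrightarrow> False"
| "formally_true Q \<kappa> (Conj \<phi> \<psi>) n \<tau> e \<longleftrightarrow>
     formally_true Q \<kappa> \<phi> n \<tau> e \<and> formally_true Q \<kappa> \<psi> n \<tau> e"
| "formally_true Q \<kappa> (Disj \<phi> \<psi>) n \<tau> e \<longleftrightarrow>
     formally_true Q \<kappa> \<phi> n \<tau> e \<or> formally_true Q \<kappa> \<psi> n \<tau> e"
| "formally_true Q \<kappa> (Exi v \<phi>) n \<tau> e \<longleftrightarrow> (\<exists>u. below n u \<and> formally_true Q \<kappa> \<phi> n \<tau> (e(v := u)))"
| "formally_true Q \<kappa> (Uni v \<phi>) n \<tau> e \<longleftrightarrow> (\<forall>q \<in> carrier Q.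
     formally_true Q \<kappa> \<phi> (Suc n) (\<tau>(Inr n := q)) (e(v := [(True, Inr n)])))"

lemma trm_val_cong: "(\<And>v. v \<in> trm_vars t \<Longrightarrow> e v = e' v) \<Longrightarrow> trm_val G e t = trm_val G e' t"
  by (induction t) auto

lemma sat_cong: "(\<And>v. v \<in> free_vars \<phi> \<Longrightarrow> e v = e' v) \<Longrightarrow> sat G \<pi> e \<phi> \<longleftrightarrow> sat G \<pi> e' \<phi>"
proof (induction \<phi> arbitrary: e e')
  case (Eq s t)
  then show ?case using trm_val_cong[of s e e' G] trm_val_cong[of t e e' G] by simp
next
  case (Pred q t)
  then show ?case using trm_val_cong[of t e e' G] by simp
next
  case (Exi v \<phi>)
  have "sat G \<pi> (e(v := g)) \<phi> \<longleftrightarrow> sat G \<pi> (e'(v := g)) \<phi>" for g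
    by (rule Exi.IH) (use Exi.prems in auto)
  then show ?case by simp
next
  case (Uni v \<phi>)
  have "sat G \<pi> (e(v := g)) \<phi> \<longleftrightarrow> sat G \<pi> (e'(v := g)) \<phi>" for g
    by (rule Uni.IH) (use Uni.prems in auto)
  then show ?case by simp
next
  case (Neg \<phi>)
  have "sat G \<pi> e \<phi> \<longleftrightarrow> sat G \<pi> e' \<phi>" by (rule Neg.IH) (use Neg.prems in auto)
  then show ?case by simp
next
  case (Conj \<phi> \<psi>)
  have "sat G \<pi> e \<phi> \<longleftrightarrow> sat G \<pi> e' \<phi>" by (rule Conj.IH) (use Conj.prems in auto)
  moreover have "sat G \<pi> e \<psi> \<longleftrightarrow> sat G \<pi> e' \<psi>" by (rule Conj.IH) (use Conj.prems in auto)
  ultimately show ?case by simp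
next
  case (Disj \<phi> \<psi>)
  have "sat G \<pi> e \<phi> \<longleftrightarrow> sat G \<pi> e' \<phi>" by (rule Disj.IH) (use Disj.prems in auto)
  moreover have "sat G \<pi> e \<psi> \<longleftrightarrow> sat G \<pi> e' \<psi>" by (rule Disj.IH) (use Disj.prems in auto)
  ultimately show ?case by simp
qed

lemma (in group) wval_fval:
  assumes h: "\<forall>x. h x \<in> carrier G"
    and c: "\<And>c. c \<in> trm_constants t \<Longrightarrow> wval G h (\<kappa> c) = c"
  shows "wval G h (fval \<kappa> e t) = trm_val G (\<lambda>v. wval G h (e v)) t"
  using c by (induction t) (auto simp: wval_append[OF h] wval_winv[OF h] h)

text \<open>
  Formal solutions can be evaluated in every group over \<open>Q\<close>, by sending the new generator that stands
  for a universal variable to the element that the variable takes there. The new generator does not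
  occur in the words chosen before, so their values are not changed.
\<close>

lemma formally_true_sound:
  assumes H: "group H" "group Q" "\<pi> \<in> hom H Q"
    and h: "\<forall>x. h x \<in> carrier H" "\<pi> \<circ> h = \<tau>"
    and e: "\<And>v. below n (e v)"
    and c: "\<And>c. c \<in> constants \<phi> \<Longrightarrow> wval H h (\<kappa> c) = c \<and> below 0 (\<kappa> c)"
    and "formally_true Q \<kappa> \<phi> n \<tau> e"
  shows "sat H \<pi> (\<lambda>v. wval H h (e v)) \<phi>"
  using h e c assms(8)
proof (induction \<phi> arbitrary: n \<tau> e h)
  case (Eq s t)
  then show ?case
    using group.wval_fval[OF H(1), of h s \<kappa> e] group.wval_fval[OF H(1), of h t \<kappa> e] by auto
next
  case (Pred q t)
  have "wval H h (fval \<kappa> e t) = trm_val H (\<lambda>v. wval H h (e v)) t"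
    by (rule group.wval_fval[OF H(1)]) (use Pred in auto)
  moreover have "wval H h (fval \<kappa> e t) \<in> carrier H"
    using Pred.prems(1) by (rule group.wval_closed[OF H(1)])
  moreover have "\<pi> (wval H h (fval \<kappa> e t)) = wval Q \<tau> (fval \<kappa> e t)"
    using hom_wval[OF H Pred.prems(1)] Pred.prems(2) by simp
  ultimately show ?case using Pred.prems by simp
next
  case (Exi v \<phi>)
  then obtain u where u: "below n u" "formally_true Q \<kappa> \<phi> n \<tau> (e(v := u))" by auto
  have "sat H \<pi> (\<lambda>w. wval H h ((e(v := u)) w)) \<phi>"
    by (rule Exi.IH[OF Exi.prems(1,2) _ _ u(2)]) (use Exi.prems u(1) in auto)
  moreover have "(\<lambda>w. wval H h ((e(v := u)) w)) = (\<lambda>w. wval H h (e w))(v := wval H h u)"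
    by auto
  moreover have "wval H h u \<in> carrier H" using Exi.prems(1) by (rule group.wval_closed[OF H(1)])
  ultimately show ?case by auto
next
  case (Uni v \<phi>)
  have "sat H \<pi> ((\<lambda>w. wval H h (e w))(v := g)) \<phi>" if g: "g \<in> carrier H" for g
  proof -
    define h' where "h' = h(Inr n := g)"
    have q: "\<pi> g \<in> carrier Q" using g H(3) by (auto simp: hom_def)
    have h': "\<forall>x. h' x \<in> carrier H" using Uni.prems(1) g by (simp add: h'_def)
    have hh: "wval H h' u = wval H h u" if "below n u" for u
    proof (rule wval_cong)
      fix x assume "x \<in> gens u"
      with that have "x \<noteq> Inr n" unfolding below_def by blast
      then show "h' x = h x" by (simp add: h'_def)
    qed
    have b0: "below 0 u \<Longrightarrow> below n u" "below n u \<Longrightarrow> below (Suc n) u"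
      for u :: "(bool \<times> (_ + nat)) list"
      by (auto simp: below_def less_Suc_eq)
    have "sat H \<pi> (\<lambda>w. wval H h' ((e(v := [(True, Inr n)])) w)) \<phi>"
    proof (rule Uni.IH[of h' "\<tau>(Inr n := \<pi> g)" "Suc n"])
      show "\<pi> \<circ> h' = \<tau>(Inr n := \<pi> g)" using Uni.prems(2) by (auto simp: h'_def)
      show "below (Suc n) ((e(v := [(True, Inr n)])) w)" for w
        using b0(2)[OF Uni.prems(3)[of w]] by (simp add: below_def)
      show "wval H h' (\<kappa> c) = c \<and> below 0 (\<kappa> c)" if "c \<in> constants \<phi>" for c
        using Uni.prems(4)[of c] that hh[OF b0(1)] by simp
      show "formally_true Q \<kappa> \<phi> (Suc n) (\<tau>(Inr n := \<pi> g)) (e(v := [(True, Inr n)]))"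
        using Uni.prems(5) q by simp
    qed (rule h')
    moreover have "(\<lambda>w. wval H h' ((e(v := [(True, Inr n)])) w)) = (\<lambda>w. wval H h (e w))(v := g)"
    proof -
      have "wval H h' [(True, Inr n)] = g"
        by (simp only: group.wval_single[OF H(1) h']) (simp add: h'_def)
      then show ?thesis using hh Uni.prems(3) by (intro ext) simp
    qed
    ultimately show ?thesis by simp
  qed
  then show ?case by simp
next
  case (Conj \<phi> \<psi>)
  have "sat H \<pi> (\<lambda>w. wval H h (e w)) \<phi>"
    by (rule Conj.IH(1)[OF Conj.prems(1-3)]) (use Conj.prems(4,5) in auto)
  moreover have "sat H \<pi> (\<lambda>w. wval H h (e w)) \<psi>"
    by (rule Conj.IH(2)[OF Conj.prems(1-3)]) (use Conj.prems(4,5) in auto)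
  ultimately show ?case by simp
next
  case (Disj \<phi> \<psi>)
  then consider "formally_true Q \<kappa> \<phi> n \<tau> e" | "formally_true Q \<kappa> \<psi> n \<tau> e" by auto
  then show ?case
  proof cases
    case 1
    have "sat H \<pi> (\<lambda>w. wval H h (e w)) \<phi>"
      by (rule Disj.IH(1)[OF Disj.prems(1-3) _ 1]) (use Disj.prems(4) in auto)
    then show ?thesis by simp
  next
    case 2
    have "sat H \<pi> (\<lambda>w. wval H h (e w)) \<psi>"
      by (rule Disj.IH(2)[OF Disj.prems(1-3) _ 2]) (use Disj.prems(4) in auto)
    then show ?thesis by simp
  qed
next
  case (Neg \<phi>)
  then show ?case by simp
qed

section \<open>Families of approximate homomorphisms\<close>

text \<open>
  A family of maps that turn elements into formal solutions. The letters \<open>Inr k\<close> with \<open>k < n\<close> are in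
  use, \<open>\<tau>\<close> gives the values in \<open>Q\<close> of the basis and of these letters, and the words in \<open>T\<close> are kept.
  A single map of the family is not multiplicative, but each product is respected by all but the
  fraction \<open>\<epsilon>\<close> of them. Later letters \<open>Inr k\<close> with \<open>n \<le> k\<close> are left alone, so that families can be
  composed.
\<close>

definition approximate_family :: "('q, 'n) monoid_scheme \<Rightarrow> nat \<Rightarrow> ('a + nat \<Rightarrow> 'q) \<Rightarrow>
    (bool \<times> ('a + nat)) list set \<Rightarrow> real \<Rightarrow> 'i set \<Rightarrow>
    ('i \<Rightarrow> (bool \<times> ('a + nat)) list \<Rightarrow> (bool \<times> ('a + nat)) list) \<Rightarrow> bool" where
  "approximate_family Q n \<tau> T \<epsilon> I \<Phi> \<longleftrightarrow> finite I \<and> I \<noteq> {} \<and>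
     (\<forall>i \<in> I.
        (\<forall>u. reduced u \<longrightarrow> reduced (\<Phi> i u) \<and> \<Phi> i (winv u) = winv (\<Phi> i u)) \<and>
        (\<forall>u k. n \<le> k \<longrightarrow> below k u \<longrightarrow> below k (\<Phi> i u)) \<and>
        (\<forall>u \<in> T. \<Phi> i u = u) \<and>
        (\<forall>k. n \<le> k \<longrightarrow> \<Phi> i [(True, Inr k)] = [(True, Inr k)]) \<and>
        (\<forall>\<sigma> u. (\<forall>y. \<sigma> y \<in> carrier Q) \<longrightarrow> (\<forall>x. \<sigma> (Inl x) = \<tau> (Inl x)) \<longrightarrow>
          (\<forall>k<n. \<sigma> (Inr k) = \<tau> (Inr k)) \<longrightarrow> wval Q \<sigma> (\<Phi> i u) = wval Q \<sigma> u)) \<and>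
     (\<forall>u v. reduced u \<longrightarrow> reduced v \<longrightarrow>
        real (card {i \<in> I. \<Phi> i (nf (u @ v)) \<noteq> nf (\<Phi> i u @ \<Phi> i v)}) \<le> \<epsilon> * real (card I))"

lemma approximate_familyD:
  fixes \<epsilon> :: real
  assumes "approximate_family Q n \<tau> T \<epsilon> I \<Phi>"
  shows "finite I" "I \<noteq> {}"
    and "i \<in> I \<Longrightarrow> reduced u \<Longrightarrow> reduced (\<Phi> i u)"
    and "i \<in> I \<Longrightarrow> reduced u \<Longrightarrow> \<Phi> i (winv u) = winv (\<Phi> i u)"
    and "i \<in> I \<Longrightarrow> n \<le> k \<Longrightarrow> below k u \<Longrightarrow> below k (\<Phi> i u)"
    and "i \<in> I \<Longrightarrow> u \<in> T \<Longrightarrow> \<Phi> i u = u"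
    and "i \<in> I \<Longrightarrow> n \<le> k \<Longrightarrow> \<Phi> i [(True, Inr k)] = [(True, Inr k)]"
    and "i \<in> I \<Longrightarrow> (\<And>y. \<sigma> y \<in> carrier Q) \<Longrightarrow> (\<And>x. \<sigma> (Inl x) = \<tau> (Inl x)) \<Longrightarrow>
      (\<And>k. k < n \<Longrightarrow> \<sigma> (Inr k) = \<tau> (Inr k)) \<Longrightarrow> wval Q \<sigma> (\<Phi> i u) = wval Q \<sigma> u"
    and "reduced u \<Longrightarrow> reduced v \<Longrightarrow>
      real (card {i \<in> I. \<Phi> i (nf (u @ v)) \<noteq> nf (\<Phi> i u @ \<Phi> i v)}) \<le> \<epsilon> * real (card I)"
  using assms unfolding approximate_family_def by (blast+)

text \<open>
  The newer family is applied first. The product that the older family has to respect then depends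
  on the index of the newer one, but the fraction of failures stays below \<open>\<epsilon>\<close> for each such index, so
  that the fractions add up. Pairs of indices are coded as longer lists to keep the
  type of the index set unchanged, which an induction over formulas requires.
\<close>

lemma approximate_family_comp:
  fixes \<epsilon> :: real
  assumes \<Phi>: "approximate_family Q n \<tau> C \<epsilon> I \<Phi>"
    and \<Psi>: "approximate_family Q (Suc n) (\<tau>(Inr n := q)) T \<epsilon> J \<Psi>"
    and "C \<subseteq> T" and "\<epsilon> \<ge> 0"
  shows "approximate_family Q (Suc n) (\<tau>(Inr n := q)) C (2 * \<epsilon>)
    ((\<lambda>(j, i). j # i) ` (J \<times> I)) (\<lambda>l u. \<Phi> (tl l) (\<Psi> (hd l) u))" (is "approximate_family _ _ _ _ _ ?K ?F")
proof -
  note A = approximate_familyD[OF \<Phi>] and B = approximate_familyD[OF \<Psi>]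
  have cK: "card ?K = card J * card I"
    by (subst card_image) (auto simp: inj_on_def card_cartesian_product)
  have "real (card {l \<in> ?K. ?F l (nf (u @ v)) \<noteq> nf (?F l u @ ?F l v)}) \<le> 2 * \<epsilon> * card ?K"
    if uv: "reduced u" "reduced v" for u v
  proof -
    define BJ where "BJ = {j \<in> J. \<Psi> j (nf (u @ v)) \<noteq> nf (\<Psi> j u @ \<Psi> j v)}"
    define BI where "BI j = {i \<in> I. \<Phi> i (nf (\<Psi> j u @ \<Psi> j v)) \<noteq> nf (\<Phi> i (\<Psi> j u) @ \<Phi> i (\<Psi> j v))}"
      for j
    have fin: "finite BJ" "finite (BI j)" for j using A(1) B(1) by (auto simp: BJ_def BI_def)
    have "{l \<in> ?K. ?F l (nf (u @ v)) \<noteq> nf (?F l u @ ?F l v)}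
        \<subseteq> (\<lambda>(j, i). j # i) ` (BJ \<times> I \<union> Sigma J BI)"
      by (auto simp: BJ_def BI_def image_iff)
    then have "card {l \<in> ?K. ?F l (nf (u @ v)) \<noteq> nf (?F l u @ ?F l v)}
        \<le> card ((\<lambda>(j, i). j # i) ` (BJ \<times> I \<union> Sigma J BI))"
      using fin A(1) B(1) by (intro card_mono finite_imageI) auto
    also have "\<dots> \<le> card (BJ \<times> I \<union> Sigma J BI)"
      using fin A(1) B(1) by (intro card_image_le) auto
    also have "\<dots> \<le> card (BJ \<times> I) + card (Sigma J BI)" by (rule card_Un_le)
    also have "\<dots> = card BJ * card I + (\<Sum>j\<in>J. card (BI j))"
      using B(1) fin by (simp add: card_cartesian_product)
    finally have "real (card {l \<in> ?K. ?F l (nf (u @ v)) \<noteq> nf (?F l u @ ?F l v)})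
        \<le> real (card BJ * card I + (\<Sum>j\<in>J. card (BI j)))"
      by (rule of_nat_mono)
    also have "\<dots> = real (card BJ) * card I + (\<Sum>j\<in>J. real (card (BI j)))" by simp
    also have "\<dots> \<le> (\<epsilon> * card J) * card I + (\<Sum>j\<in>J. \<epsilon> * card I)"
      using A(9)[OF B(3,3)] B(9)[OF uv] uv
      by (intro add_mono mult_right_mono sum_mono) (auto simp: BJ_def BI_def)
    finally show ?thesis by (simp add: cK algebra_simps)
  qed
  moreover have "finite ?K" "?K \<noteq> {}" using A(1,2) B(1,2) by auto
  moreover have "wval Q \<sigma> (\<Phi> i (\<Psi> j u)) = wval Q \<sigma> u"
    if "i \<in> I" "j \<in> J" "\<forall>y. \<sigma> y \<in> carrier Q" "\<forall>x. \<sigma> (Inl x) = (\<tau>(Inr n := q)) (Inl x)"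
      "\<forall>k<Suc n. \<sigma> (Inr k) = (\<tau>(Inr n := q)) (Inr k)" for i j \<sigma> u
  proof -
    have "wval Q \<sigma> (\<Phi> i (\<Psi> j u)) = wval Q \<sigma> (\<Psi> j u)"
      by (rule A(8)) (use that in auto)
    also have "\<dots> = wval Q \<sigma> u" by (rule B(8)) (use that in auto)
    finally show ?thesis .
  qed
  ultimately show ?thesis
    using A(3-7) B(3-7) \<open>C \<subseteq> T\<close>
    unfolding approximate_family_def by (auto simp: subset_iff)
qed

section \<open>Words in a basis\<close>

locale free_group_on = group G for G :: "('a, 'm) monoid_scheme" (structure) +
  fixes X :: "'a set"
  assumes basis: "free_basis G X"
begin

text \<open>
  The trivial value outside the basis makes this a total map into the group, so that words in
  arbitrary letters have a value.
\<close>

definition gen :: "'a + nat \<Rightarrow> 'a" where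
  "gen y = (case y of Inl x \<Rightarrow> if x \<in> X then x else \<one> | Inr k \<Rightarrow> \<one>)"

definition word :: "'a \<Rightarrow> (bool \<times> ('a + nat)) list" where
  "word g = map (map_prod id Inl)
     (inv_into (reduced_words X) (\<lambda>w. list_prod G (map (letter_val G) w)) g)"

lemma gen_closed: "\<forall>y. gen y \<in> carrier G"
  using basis by (auto simp: gen_def free_basis_def split: sum.split)

lemma wval_gen_Inl:
  assumes "gens w \<subseteq> X"
  shows "wval G gen (map (map_prod id Inl) w) = list_prod G (map (letter_val G) w)"
  using assms by (induction w) (auto simp: wval_Cons list_prod_def gen_def split: prod.splits)

lemma reduced_map_Inl: "reduced (map (map_prod id (Inl :: _ \<Rightarrow> _ + nat)) w) \<longleftrightarrow> reduced w"
  by (auto simp: reduced_def successively_map linv_def prod_eq_iff cong: successively_cong)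

lemma wval_word: "g \<in> carrier G \<Longrightarrow> wval G gen (word g) = g"
  and reduced_word: "g \<in> carrier G \<Longrightarrow> reduced (word g)"
  and gens_word: "g \<in> carrier G \<Longrightarrow> gens (word g) \<subseteq> Inl ` X"
proof -
  assume g: "g \<in> carrier G"
  define V where "V = (\<lambda>w. list_prod G (map (letter_val G) w))"
  define w where "w = inv_into (reduced_words X) V g"
  have V: "bij_betw V (reduced_words X) (carrier G)"
    using basis by (simp add: free_basis_def V_def)
  then have w: "w \<in> reduced_words X" "V w = g"
    using g by (auto simp: w_def bij_betw_def intro: inv_into_into f_inv_into_f)
  have word: "word g = map (map_prod id Inl) w" by (simp add: word_def w_def V_def)
  from w(1) have w': "gens w \<subseteq> X" "reduced w" by (simp_all add: reduced_words_iff)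
  show "wval G gen (word g) = g" using w(2) w'(1) by (simp add: word wval_gen_Inl V_def)
  show "reduced (word g)" using w'(2) by (simp add: word reduced_map_Inl)
  show "gens (word g) \<subseteq> Inl ` X" using w'(1) by (force simp: word)
qed

text \<open>
  The uniqueness of reduced words; it turns multiplication in the group into free reduction.
\<close>

lemma word_wval:
  assumes "reduced u" "gens u \<subseteq> Inl ` X"
  shows "word (wval G gen u) = u"
proof -
  define V where "V = (\<lambda>w. list_prod G (map (letter_val G) w))"
  define w where "w = map (map_prod id projl) u"
  have "map (map_prod id Inl) w = map id u"
    unfolding w_def map_map using assms(2) by (intro map_cong) (force simp: prod_eq_iff)+
  then have u: "u = map (map_prod id Inl) w" by simp
  have gw: "gens w \<subseteq> X" using assms(2) by (force simp: w_def)
  have "w \<in> reduced_words X"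
    using assms(1) gw u reduced_map_Inl[of w] by (simp add: reduced_words_iff)
  moreover have "inj_on V (reduced_words X)"
    using basis by (simp add: free_basis_def V_def bij_betw_def)
  moreover have "wval G gen u = V w" using u gw by (simp add: wval_gen_Inl V_def)
  ultimately show ?thesis using u by (simp add: word_def flip: V_def)
qed

lemma below_word: "g \<in> carrier G \<Longrightarrow> below n (word g)"
  using gens_word unfolding below_def by blast

lemma word_one: "word \<one> = []"
  using word_wval[of "[]"] by simp

lemma word_mult: "g \<in> carrier G \<Longrightarrow> h \<in> carrier G \<Longrightarrow> word (g \<otimes> h) = nf (word g @ word h)"
  using word_wval[of "nf (word g @ word h)"] gens_nf[of "word g @ word h"] gens_word[of g] gens_word[of h]
  by (simp add: gen_closed wval_append wval_word image_Un) (meson le_sup_iff order_trans)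

lemma word_inv: "g \<in> carrier G \<Longrightarrow> word (inv g) = winv (word g)"
  using word_wval[of "winv (word g)"]
  by (simp add: gen_closed wval_winv wval_word reduced_word gens_word)

end

section \<open>From truth to formal truth\<close>

lemma (in monoid) wval_replicate:
  "f x \<in> carrier G \<Longrightarrow> wval G f (replicate k (True, x)) = f x [^] k"
  by (induction k) (simp add: wval_Cons letter_val_def, metis nat_pow_Suc2 wval_Cons letter_val_def
      replicate_Suc fst_conv snd_conv)

text \<open>
  The value of a term is computed correctly by a map unless the map fails at one of the
  multiplications, so these are counted.
\<close>

primrec trm_cost :: "'c trm \<Rightarrow> nat" where
  "trm_cost (Var n) = 0"
| "trm_cost (Const c) = 0"
| "trm_cost One = 0"
| "trm_cost (Mult s t) = trm_cost s + trm_cost t + 1"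
| "trm_cost (Inv t) = trm_cost t"

text \<open>
  At a universal quantifier a second family is composed with the first one, which doubles the fraction
  of failures, and this happens once for each of the \<open>k\<close> elements of \<open>Q\<close>.
\<close>

primrec cost :: "nat \<Rightarrow> ('c, 'q) fm \<Rightarrow> nat" where
  "cost k (Eq s t) = trm_cost s + trm_cost t"
| "cost k (Pred q t) = trm_cost t"
| "cost k (Neg \<phi>) = 0"
| "cost k (Conj \<phi> \<psi>) = cost k \<phi> + cost k \<psi>"
| "cost k (Disj \<phi> \<psi>) = cost k \<phi> + cost k \<psi>"
| "cost k (Exi n \<phi>) = cost k \<phi>"
| "cost k (Uni n \<phi>) = 2 * k * cost k \<phi>"

locale labelled_free_group = free_group_on G X
  for G :: "('a, 'm) monoid_scheme" (structure) and X +
  fixes Q :: "('q, 'n) monoid_scheme" and \<pi> :: "'a \<Rightarrow> 'q" and a b :: 'a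
  assumes Q: "group Q" "finite (carrier Q)"
    and \<pi>: "\<pi> \<in> epi G Q"
    and ab: "a \<in> X" "b \<in> X" "a \<noteq> b"
begin

abbreviation label :: "'a + nat \<Rightarrow> 'q" where
  "label y \<equiv> \<pi> (gen y)"

lemma \<pi>_hom: "\<pi> \<in> hom G Q" and \<pi>_surj: "\<pi> ` carrier G = carrier Q"
  using \<pi> by (auto simp: epi_def)

lemma label_closed: "\<forall>y. label y \<in> carrier Q"
  using \<pi>_hom gen_closed by (auto simp: hom_def)

lemma wval_label: "wval Q label u = \<pi> (wval G gen u)"
  using hom_wval[OF is_group Q(1) \<pi>_hom gen_closed] by (simp add: comp_def)

text \<open>
  The condition on the first letter is met by putting a power of \<open>a\<close> in front whose exponent is the
  order of \<open>Q\<close>: this does not change the value in \<open>Q\<close>.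
\<close>

lemma ex_tail:
  assumes "q \<in> carrier Q"
  shows "\<exists>s. reduced s \<and> gens s \<subseteq> Inl ` X \<and> wval Q label s = q \<and> (s \<noteq> [] \<longrightarrow> hd s \<noteq> (False, Inl b))"
proof -
  interpret Q: group Q by (rule Q(1))
  obtain g where g: "g \<in> carrier G" "\<pi> g = q" 
    using assms unfolding \<pi>_surj[symmetric] by blast
  define u where "u = word g"
  have u: "reduced u" "gens u \<subseteq> Inl ` X" "wval Q label u = q"
    using g by (simp_all add: u_def reduced_word gens_word wval_label wval_word)
  show ?thesis
  proof (cases "u \<noteq> [] \<and> hd u = (False, Inl b)")
    case True
    define p where "p = replicate (order Q) (True, Inl a :: 'a + nat)"
    have ne: "order Q > 0" using Q(2) Q.order_gt_0_iff_finite by blast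
    have "wval Q label p = \<one>\<^bsub>Q\<^esub>"
      using Q.wval_replicate[of label "Inl a" "order Q"] Q.pow_order_eq_1 label_closed
      by (simp add: p_def)
    then have "wval Q label (p @ u) = q"
      using u(3) assms by (simp add: Q.wval_append[OF label_closed])
    moreover have "reduced (p @ u)"
    proof -
      have "reduced p" by (rule reduced_positive) (simp add: p_def)
      moreover have "p \<noteq> []" "last p = (True, Inl a)" using ne by (auto simp: p_def)
      ultimately show ?thesis using u(1) True ab by (simp add: reduced_append_iff linv_def)
    qed
    moreover have "hd (p @ u) \<noteq> (False, Inl b)" using ne by (cases "order Q") (auto simp: p_def)
    moreover have "gens (p @ u) \<subseteq> Inl ` X" using u(2) ab by (auto simp: p_def)
    ultimately show ?thesis by blast
  qed (use u in blast)
qed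

text \<open>
  An element \<open>m\<close> that behaves like a free generator of value \<open>q\<close>. Its word is a product of \<open>N\<close> pieces,
  followed by a tail that corrects the value in \<open>Q\<close>. The \<open>j\<close>-th map of the family replaces the \<open>j\<close>-th
  piece so that this word becomes the letter \<open>Inr n\<close>. As each product is spoiled for at most three
  pieces, \<open>N \<ge> 3 / \<epsilon>\<close> of them suffice.
\<close>

lemma ex_generic_element:
  fixes \<epsilon> :: real
  assumes q: "q \<in> carrier Q" and T: "finite T" "\<And>u. u \<in> T \<Longrightarrow> reduced u" and \<epsilon>: "0 < \<epsilon>"
    and \<tau>: "\<And>x. \<tau> (Inl x) = label (Inl x)"
  obtains m and J :: "nat set" and \<Psi>
  where "m \<in> carrier G" "approximate_family Q (Suc n) (\<tau>(Inr n := q)) T \<epsilon> J \<Psi>"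
    "\<And>j. j \<in> J \<Longrightarrow> \<Psi> j (word m) = [(True, Inr n)]"
proof -
  interpret Q: group Q by (rule Q(1))
  obtain N :: nat where N: "3 / \<epsilon> < N" using reals_Archimedean2 by blast
  with \<epsilon> have N3: "3 \<le> \<epsilon> * N" by (simp add: field_simps)
  have N0: "0 < N" using N \<epsilon> by (cases N) auto
  obtain S where S: "reduced (S p)" "gens (S p) \<subseteq> Inl ` X" "wval Q label (S p) = p"
      "S p \<noteq> [] \<Longrightarrow> hd (S p) \<noteq> (False, Inl b)" if "p \<in> carrier Q" for p
    using ex_tail by metis
  \<comment> \<open>The tail depends on the value in \<open>Q\<close> of the pieces, hence on \<open>P\<close>. So \<open>P\<close> has to dominate the
    tails for all the values in the finite group \<open>Q\<close>.\<close>
  define P where "P = 2 + Max (length ` (T \<union> S ` carrier Q))"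
  have P: "length u \<le> P" if "u \<in> T \<union> S ` carrier Q" for u
    using that T(1) Q(2) unfolding P_def by (intro trans_le_add2 Max_ge) auto
  define w where "w = piece (Inl a :: 'a + nat) (Inl b) P N"
  define c where "c = wval Q label (concat (map w [0..<N]))"
  have c: "c \<in> carrier Q" unfolding c_def using label_closed by (rule Q.wval_closed)
  define s where "s = S (inv\<^bsub>Q\<^esub> c \<otimes>\<^bsub>Q\<^esub> q)"
  have cq: "inv\<^bsub>Q\<^esub> c \<otimes>\<^bsub>Q\<^esub> q \<in> carrier Q"
    using c q by simp
  note s = S[OF cq, folded s_def]
  define M where "M = long_word (Inl a) (Inl b) P N s"
  define z where "z = (Inr n :: 'a + nat)"
  define r where "r = piece_replacement (Inl a) (Inl b) P N s z"
  have ab': "(Inl a :: 'a + nat) \<noteq> Inl b" using ab by simp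
  have P2: "2 \<le> P" by (simp add: P_def)
  note W = nonoverlapping_pieces[OF ab' P2, of N, folded w_def]
  note D = nonoverlappingD[OF W]
  have len: "length s < P + N + 2" using P[of s] cq by (simp add: s_def)
  have rM: "reduced M" unfolding M_def by (rule reduced_long_word[OF N0 s(1,4)])
  have gw: "gens (w j) \<subseteq> Inl ` X" for j using ab by (auto simp: w_def piece_def)
  have gM: "gens M \<subseteq> Inl ` X"
    using gw s(2) unfolding M_def long_word_def w_def[symmetric] by auto
  have vM: "wval Q label M = q"
    using s(3) c q unfolding M_def long_word_def w_def[symmetric]
    by (simp add: Q.wval_append[OF label_closed] c_def[symmetric] Q.m_assoc[symmetric])
  have gr: "gens (r j) \<subseteq> insert z (Inl ` X)" for j
  proof -
    have "gens (r j) \<subseteq> insert z (\<Union>(gens ` w ` UNIV) \<union> gens s)"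
      unfolding r_def piece_replacement_def w_def[symmetric]
      by (simp only: set_append image_Un winv_simps(6)) auto
    moreover have "\<Union>(gens ` w ` UNIV) \<subseteq> Inl ` X" using gw by blast
    ultimately show ?thesis using s(2) by blast
  qed
  define \<Psi> where "\<Psi> j = substw (w j) (r j)" for j
  have "approximate_family Q (Suc n) (\<tau>(Inr n := q)) T \<epsilon> {..<N} \<Psi>"
    unfolding approximate_family_def
  proof (intro conjI ballI allI impI)
    show "finite {..<N}" "{..<N} \<noteq> {}" using N0 by auto
  next
    fix j u assume j: "j \<in> {..<N}"
    then have wj: "w j \<in> w ` {..<N}" by blast
    show "reduced (\<Psi> j u)" by (simp add: \<Psi>_def substw_def)
    show "\<Psi> j (winv u) = winv (\<Psi> j u)"
      by (simp add: \<Psi>_def substw_def repl_winv[OF W wj] nf_winv)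
    show "\<Psi> j u = u" if "u \<in> T"
    proof -
      have "length u < length (w j)" using P[of u] that by (simp add: w_def)
      then show ?thesis using T(2)[OF that] by (simp add: \<Psi>_def substw_def repl_short)
    qed
    show "\<Psi> j [(True, Inr k)] = [(True, Inr k)]" for k
    proof -
      have "length [(True, Inr k :: 'a + nat)] < length (w j)" by (simp add: w_def)
      then show ?thesis unfolding \<Psi>_def substw_def by (simp only: repl_short) simp
    qed
    show "below k (\<Psi> j u)" if "Suc n \<le> k" "below k u" for k
    proof -
      have "gens (\<Psi> j u) \<subseteq> gens u \<union> insert z (Inl ` X)"
        using gens_nf[of "repl (w j) (r j) u"] gens_repl[OF D(2)[OF wj], of "r j" u] gr[of j]
        unfolding \<Psi>_def substw_def by blast
      then have "Inr l \<in> gens u \<or> l = n" if "Inr l \<in> gens (\<Psi> j u)" for l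
        using that unfolding z_def by blast
      with that show ?thesis unfolding below_def by (metis Suc_le_lessD)
    qed
    show "wval Q \<sigma> (\<Psi> j u) = wval Q \<sigma> u"
      if \<sigma>: "\<forall>y. \<sigma> y \<in> carrier Q" "\<forall>x. \<sigma> (Inl x) = (\<tau>(Inr n := q)) (Inl x)"
        "\<forall>k<Suc n. \<sigma> (Inr k) = (\<tau>(Inr n := q)) (Inr k)" for \<sigma>
    proof -
      have "wval Q \<sigma> M = wval Q label M"
        by (rule wval_cong) (use gM \<sigma>(2) \<tau> in auto)
      moreover have "\<sigma> z = q" using \<sigma>(3) by (simp add: z_def)
      ultimately have "wval Q \<sigma> (r j) = wval Q \<sigma> (w j)"
        unfolding r_def w_def using j \<sigma>(1) vM
        by (intro Q.wval_piece_replacement) (auto simp: M_def)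
      then show ?thesis
        unfolding \<Psi>_def substw_def
        by (simp only: Q.wval_nf[OF \<sigma>(1)]
            Q.wval_repl[OF \<sigma>(1) _ D(2)[OF wj]])
    qed
  next
    fix u v :: "(bool \<times> ('a + nat)) list" assume uv: "reduced u" "reduced v"
    have "card {j \<in> {..<N}. \<Psi> j (nf (u @ v)) \<noteq> nf (\<Psi> j u @ \<Psi> j v)} \<le> 3"
      unfolding \<Psi>_def using inj_on_piece[OF ab', of P N, folded w_def]
      by (intro card_substw_mult_fails[OF W _ _ uv]) auto
    then have "real (card {j \<in> {..<N}. \<Psi> j (nf (u @ v)) \<noteq> nf (\<Psi> j u @ \<Psi> j v)}) \<le> 3" by simp
    also have "\<dots> \<le> \<epsilon> * real (card {..<N})" using N3 by simp
    finally show "real (card {j \<in> {..<N}. \<Psi> j (nf (u @ v)) \<noteq> nf (\<Psi> j u @ \<Psi> j v)})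
        \<le> \<epsilon> * real (card {..<N})" .
  qed
  moreover have "\<Psi> j (word (wval G gen M)) = [(True, Inr n)]" if "j \<in> {..<N}" for j
  proof -
    have "\<Psi> j M = [(True, Inr n)]"
      using substw_long_word[OF ab' P2 _ len, of j z] that
      by (simp add: \<Psi>_def w_def r_def M_def z_def)
    then show ?thesis by (simp only: word_wval[OF rM gM])
  qed
  ultimately show ?thesis using that gen_closed by (metis wval_closed)
qed

lemma trm_val_closed:
  "range e \<subseteq> carrier G \<Longrightarrow> trm_constants t \<subseteq> carrier G \<Longrightarrow> trm_val G e t \<in> carrier G"
  by (induction t) auto

lemma card_fval_fails:
  fixes \<epsilon> :: real
  assumes \<Phi>: "approximate_family Q n \<tau> C \<epsilon> I \<Phi>" and C: "[] \<in> C"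
    and e: "range e \<subseteq> carrier G"
    and t: "trm_constants t \<subseteq> carrier G" "word ` trm_constants t \<subseteq> C"
  shows "real (card {i \<in> I. fval word (\<lambda>v. \<Phi> i (word (e v))) t \<noteq> \<Phi> i (word (trm_val G e t))})
    \<le> trm_cost t * (\<epsilon> * card I)"
  using t
proof (induction t)
  case (Mult s t)
  note A = approximate_familyD[OF \<Phi>]
  let ?B = "\<lambda>t. {i \<in> I. fval word (\<lambda>v. \<Phi> i (word (e v))) t \<noteq> \<Phi> i (word (trm_val G e t))}"
  let ?g = "trm_val G e s" and ?h = "trm_val G e t"
  have c: "?g \<in> carrier G" "?h \<in> carrier G" using Mult.prems e by (auto intro: trm_val_closed)
  let ?M = "{i \<in> I. \<Phi> i (nf (word ?g @ word ?h)) \<noteq> nf (\<Phi> i (word ?g) @ \<Phi> i (word ?h))}"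
  have "?B (Mult s t) \<subseteq> ?B s \<union> (?B t \<union> ?M)" using c by (auto simp: word_mult)
  then have "card (?B (Mult s t)) \<le> card (?B s \<union> (?B t \<union> ?M))"
    using A(1) by (intro card_mono) auto
  also have "\<dots> \<le> card (?B s) + (card (?B t) + card ?M)"
    using card_Un_le[of "?B s" "?B t \<union> ?M"] card_Un_le[of "?B t" ?M] by linarith
  finally have "real (card (?B (Mult s t))) \<le> real (card (?B s)) + (real (card (?B t)) + card ?M)"
    by linarith
  also have "\<dots> \<le> trm_cost s * (\<epsilon> * card I) + (trm_cost t * (\<epsilon> * card I) + \<epsilon> * card I)"
    using Mult A(9)[OF reduced_word[OF c(1)] reduced_word[OF c(2)]] by (intro add_mono) auto
  finally show ?case by (simp add: algebra_simps)
next
  case (Inv t)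
  note A = approximate_familyD[OF \<Phi>]
  have c: "trm_val G e t \<in> carrier G" using Inv.prems e by (auto intro: trm_val_closed)
  have "{i \<in> I. fval word (\<lambda>v. \<Phi> i (word (e v))) (Inv t) \<noteq> \<Phi> i (word (trm_val G e (Inv t)))}
    = {i \<in> I. fval word (\<lambda>v. \<Phi> i (word (e v))) t \<noteq> \<Phi> i (word (trm_val G e t))}"
    using A(4) c by (auto simp: word_inv reduced_word)
  then show ?case using Inv by simp
next
  case (Const c)
  then have "\<Phi> i (word c) = word c" if "i \<in> I" for i
    using that by (intro approximate_familyD(6)[OF \<Phi>]) auto
  then have *: "{i \<in> I. word c \<noteq> \<Phi> i (word c)} = {}" by auto
  show ?case unfolding fval.simps trm_val.simps * by simp
next
  case One
  have *: "{i \<in> I. [] \<noteq> \<Phi> i []} = {}" using approximate_familyD(6)[OF \<Phi> _ C] by auto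
  show ?case unfolding fval.simps trm_val.simps word_one * by simp
qed simp

end

context labelled_free_group
begin

text \<open>
  The maps to be used are determined only by the products that occur anywhere in the evaluation of
  the formula, in particular by witnesses of later existential quantifiers. This is why the claim
  is about most of the maps at once: a choice among them is made only at the end. The bound is
  proved for every precision \<open>\<epsilon>\<close>, because the families are refined inside the induction.
\<close>

lemma sat_imp_mostly_formally_true:
  fixes \<epsilon> :: real and I :: "nat list set"
  assumes C: "[] \<in> C" "finite C" "\<And>u. u \<in> C \<Longrightarrow> reduced u" and \<epsilon>: "0 < \<epsilon>"
    and "approximate_family Q n \<tau> C \<epsilon> I \<Phi>"
    and "\<And>x. \<tau> (Inl x) = label (Inl x)" "\<And>y. \<tau> y \<in> carrier Q"
    and "range e \<subseteq> carrier G" "finite (range e)"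
    and "constants \<phi> \<subseteq> carrier G" "word ` constants \<phi> \<subseteq> C"
    and "positive \<phi>" "sat G \<pi> e \<phi>"
  shows "real (card {i \<in> I. \<not> formally_true Q word \<phi> n \<tau> (\<lambda>v. \<Phi> i (word (e v)))})
    \<le> cost (card (carrier Q)) \<phi> * (\<epsilon> * card I)"
  using assms(4-)
proof (induction \<phi> arbitrary: n \<tau> \<epsilon> I \<Phi> e)
  case (Eq s t)
  note A = approximate_familyD[OF Eq.prems(2)]
  let ?B = "\<lambda>t. {i \<in> I. fval word (\<lambda>v. \<Phi> i (word (e v))) t \<noteq> \<Phi> i (word (trm_val G e t))}"
  have "{i \<in> I. \<not> formally_true Q word (Eq s t) n \<tau> (\<lambda>v. \<Phi> i (word (e v)))} \<subseteq> ?B s \<union> ?B t"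
    using Eq.prems by auto
  then have "card {i \<in> I. \<not> formally_true Q word (Eq s t) n \<tau> (\<lambda>v. \<Phi> i (word (e v)))}
      \<le> card (?B s \<union> ?B t)"
    using A(1) by (intro card_mono) auto
  also have "\<dots> \<le> card (?B s) + card (?B t)" by (rule card_Un_le)
  finally have "real (card {i \<in> I. \<not> formally_true Q word (Eq s t) n \<tau> (\<lambda>v. \<Phi> i (word (e v)))})
      \<le> real (card (?B s)) + real (card (?B t))" by linarith
  also have "\<dots> \<le> trm_cost s * (\<epsilon> * card I) + trm_cost t * (\<epsilon> * card I)"
    using Eq.prems by (intro add_mono card_fval_fails[OF Eq.prems(2) C(1)]) (auto simp: image_Un)
  finally show ?case by (simp add: algebra_simps)
next
  case (Pred q t)
  note A = approximate_familyD[OF Pred.prems(2)]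
  let ?B = "{i \<in> I. fval word (\<lambda>v. \<Phi> i (word (e v))) t \<noteq> \<Phi> i (word (trm_val G e t))}"
  let ?g = "trm_val G e t"
  have g: "?g \<in> carrier G" "\<pi> ?g = q" using Pred.prems(10) by simp_all
  have "wval Q \<tau> (\<Phi> i (word ?g)) = q" if "i \<in> I" for i
  proof -
    have "wval Q \<tau> (\<Phi> i (word ?g)) = wval Q \<tau> (word ?g)"
      by (rule A(8)[OF that]) (simp_all add: Pred.prems(4))
    also have "\<dots> = wval Q label (word ?g)"
      by (rule wval_cong) (use gens_word[OF g(1)] Pred.prems(3) in auto)
    also have "\<dots> = q" using g by (simp add: wval_label wval_word)
    finally show ?thesis .
  qed
  then have "{i \<in> I. \<not> formally_true Q word (Pred q t) n \<tau> (\<lambda>v. \<Phi> i (word (e v)))} \<subseteq> ?B"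
    by auto
  then have "card {i \<in> I. \<not> formally_true Q word (Pred q t) n \<tau> (\<lambda>v. \<Phi> i (word (e v)))} \<le> card ?B"
    using A(1) by (intro card_mono) auto
  also have "real (card ?B) \<le> trm_cost t * (\<epsilon> * card I)"
    using Pred.prems by (intro card_fval_fails[OF Pred.prems(2) C(1)]) auto
  finally show ?case by simp
next
  case (Neg \<phi>)
  then show ?case by simp
next
  case (Conj \<phi> \<psi>)
  let ?B = "\<lambda>\<phi>. {i \<in> I. \<not> formally_true Q word \<phi> n \<tau> (\<lambda>v. \<Phi> i (word (e v)))}"
  have "?B (Conj \<phi> \<psi>) = ?B \<phi> \<union> ?B \<psi>" by auto
  then have "card (?B (Conj \<phi> \<psi>)) \<le> card (?B \<phi>) + card (?B \<psi>)" by (simp only: card_Un_le)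
  then have "real (card (?B (Conj \<phi> \<psi>))) \<le> real (card (?B \<phi>)) + real (card (?B \<psi>))"
    by linarith
  also have "\<dots> \<le> cost (card (carrier Q)) \<phi> * (\<epsilon> * card I) + cost (card (carrier Q)) \<psi> * (\<epsilon> * card I)"
    using Conj.prems by (intro add_mono Conj.IH) auto
  finally show ?case by (simp add: algebra_simps)
next
  case (Disj \<phi> \<psi>)
  note A = approximate_familyD[OF Disj.prems(2)]
  let ?B = "\<lambda>\<phi>. {i \<in> I. \<not> formally_true Q word \<phi> n \<tau> (\<lambda>v. \<Phi> i (word (e v)))}"
  obtain \<chi> where \<chi>: "\<chi> = \<phi> \<or> \<chi> = \<psi>" "sat G \<pi> e \<chi>" using Disj.prems(10) by auto
  have "real (card (?B (Disj \<phi> \<psi>))) \<le> real (card (?B \<chi>))"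
    using A(1) \<chi>(1) by (intro of_nat_mono card_mono) auto
  also have "\<dots> \<le> cost (card (carrier Q)) \<chi> * (\<epsilon> * card I)"
    using \<chi>(1)
  proof
    assume "\<chi> = \<phi>"
    with \<chi>(2) Disj.prems show ?thesis by (auto intro!: Disj.IH(1))
  next
    assume "\<chi> = \<psi>"
    with \<chi>(2) Disj.prems show ?thesis by (auto intro!: Disj.IH(2))
  qed
  also have "\<dots> \<le> cost (card (carrier Q)) (Disj \<phi> \<psi>) * (\<epsilon> * card I)"
    using \<chi>(1) Disj.prems(1) by (intro mult_right_mono) auto
  finally show ?case .
next
  case (Exi v \<phi>)
  note A = approximate_familyD[OF Exi.prems(2)]
  obtain g where g: "g \<in> carrier G" "sat G \<pi> (e(v := g)) \<phi>" using Exi.prems(10) by auto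
  have env: "(\<lambda>w. \<Phi> i (word ((e(v := g)) w))) = (\<lambda>w. \<Phi> i (word (e w)))(v := \<Phi> i (word g))" for i
    by auto
  have "below n (\<Phi> i (word g))" if "i \<in> I" for i
    using A(5)[OF that order.refl below_word[OF g(1)]] .
  then have "{i \<in> I. \<not> formally_true Q word (Exi v \<phi>) n \<tau> (\<lambda>w. \<Phi> i (word (e w)))}
      \<subseteq> {i \<in> I. \<not> formally_true Q word \<phi> n \<tau> (\<lambda>w. \<Phi> i (word ((e(v := g)) w)))}"
    unfolding env formally_true.simps by blast
  then have "card {i \<in> I. \<not> formally_true Q word (Exi v \<phi>) n \<tau> (\<lambda>w. \<Phi> i (word (e w)))}
      \<le> card {i \<in> I. \<not> formally_true Q word \<phi> n \<tau> (\<lambda>w. \<Phi> i (word ((e(v := g)) w)))}"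
    using A(1) by (intro card_mono) auto
  also have "real \<dots> \<le> cost (card (carrier Q)) \<phi> * (\<epsilon> * card I)"
  proof (rule Exi.IH[OF Exi.prems(1-4)])
    show "range (e(v := g)) \<subseteq> carrier G" using Exi.prems(5) g(1) by auto
    show "finite (range (e(v := g)))"
      by (rule finite_subset[of _ "insert g (range e)"]) (use Exi.prems(6) in auto)
    show "sat G \<pi> (e(v := g)) \<phi>" by (rule g(2))
  qed (use Exi.prems in auto)
  finally show ?case by simp
next
  case (Uni v \<phi>)
  note A = approximate_familyD[OF Uni.prems(2)]
  let ?k = "cost (card (carrier Q)) \<phi>"
  define B where "B q = {i \<in> I. \<not> formally_true Q word \<phi> (Suc n) (\<tau>(Inr n := q))
    ((\<lambda>w. \<Phi> i (word (e w)))(v := [(True, Inr n)]))}" for q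
  have B: "real (card (B q)) \<le> 2 * ?k * (\<epsilon> * card I)" if q: "q \<in> carrier Q" for q
  proof -
    have T: "finite (C \<union> word ` range e)" "\<And>u. u \<in> C \<union> word ` range e \<Longrightarrow> reduced u"
      using C Uni.prems(5,6) reduced_word by auto
    obtain m J \<Psi> where m: "m \<in> carrier G"
      and \<Psi>: "approximate_family Q (Suc n) (\<tau>(Inr n := q)) (C \<union> word ` range e) \<epsilon> (J :: nat set) \<Psi>"
      and \<Psi>m: "\<And>j. j \<in> J \<Longrightarrow> \<Psi> j (word m) = [(True, Inr n)]"
      using ex_generic_element[OF q T Uni.prems(1,3)] by blast
    let ?K = "(\<lambda>(j, i). j # i) ` (J \<times> I)" and ?F = "\<lambda>l u. \<Phi> (tl l) (\<Psi> (hd l) u)"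
    have F: "approximate_family Q (Suc n) (\<tau>(Inr n := q)) C (2 * \<epsilon>) ?K ?F"
      using approximate_family_comp[OF Uni.prems(2) \<Psi>] Uni.prems(1) by simp
    \<comment> \<open>The formal environment does not depend on \<open>j\<close>, since the newer maps keep all earlier values
      and send \<open>m\<close> to the new letter. So the bad pairs form a product set, and the bound for them
      gives the same bound for the older family alone.\<close>
    have env: "(\<lambda>w. \<Phi> i (\<Psi> j (word ((e(v := m)) w)))) = (\<lambda>w. \<Phi> i (word (e w)))(v := [(True, Inr n)])"
      if "j \<in> J" "i \<in> I" for i j
      using approximate_familyD(6)[OF \<Psi> that(1)] \<Psi>m[OF that(1)] A(7)[OF that(2)] by auto
    have "card (J \<times> B q) = card ((\<lambda>(j, i). j # i) ` (J \<times> B q))"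
      by (rule card_image[symmetric]) (auto simp: inj_on_def)
    also have "(\<lambda>(j, i). j # i) ` (J \<times> B q) = {l \<in> ?K. \<not> formally_true Q word \<phi> (Suc n)
        (\<tau>(Inr n := q)) (\<lambda>w. ?F l (word ((e(v := m)) w)))}"
      using env by (auto simp: B_def image_iff)
    also have "real (card \<dots>) \<le> ?k * (2 * \<epsilon> * card ?K)"
    proof (rule Uni.IH[OF _ F])
      show "range (e(v := m)) \<subseteq> carrier G" using Uni.prems(5) m by auto
      show "finite (range (e(v := m)))"
        by (rule finite_subset[of _ "insert m (range e)"]) (use Uni.prems(6) in auto)
      show "sat G \<pi> (e(v := m)) \<phi>" using Uni.prems(10) m by simp
    qed (use Uni.prems q in auto)
    also have "card ?K = card J * card I"
      by (subst card_image) (auto simp: inj_on_def card_cartesian_product)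
    finally have "card J * real (card (B q)) \<le> card J * (2 * ?k * (\<epsilon> * card I))"
      by (simp add: card_cartesian_product algebra_simps)
    moreover have "0 < real (card J)"
      using approximate_familyD(1,2)[OF \<Psi>] by (simp add: card_gt_0_iff)
    ultimately show ?thesis by (rule mult_left_le_imp_le)
  qed
  have "{i \<in> I. \<not> formally_true Q word (Uni v \<phi>) n \<tau> (\<lambda>w. \<Phi> i (word (e w)))} = \<Union>(B ` carrier Q)"
    by (auto simp: B_def)
  then have "real (card {i \<in> I. \<not> formally_true Q word (Uni v \<phi>) n \<tau> (\<lambda>w. \<Phi> i (word (e w)))})
      \<le> real (\<Sum>q\<in>carrier Q. card (B q))"
    by (simp only: of_nat_le_iff card_UN_le[OF Q(2)])
  also have "\<dots> = (\<Sum>q\<in>carrier Q. real (card (B q)))" by simp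
  also have "\<dots> \<le> (\<Sum>q\<in>carrier Q. 2 * ?k * (\<epsilon> * card I))" by (intro sum_mono B)
  finally show ?case by (simp add: algebra_simps)
qed

lemma finite_constants: "finite (constants \<phi>)"
proof (induction \<phi>)
  have "finite (trm_constants t)" for t by (induction t) auto
  then show "finite (constants (Eq s t))" "finite (constants (Pred q t))" for s t q by auto
qed auto

text \<open>
  The family that consists of the identity respects all products, so it may be used with an \<open>\<epsilon>\<close> so
  small that the fraction of failures is less than one, that is, zero.
\<close>

lemma sat_imp_formally_true:
  assumes \<phi>: "constants \<phi> \<subseteq> carrier G" "positive \<phi>" "sat G \<pi> (\<lambda>_. \<one>) \<phi>"
  shows "formally_true Q word \<phi> 0 label (\<lambda>_. [])"
proof -
  let ?C = "insert [] (word ` constants \<phi>)"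
  define k where "k = cost (card (carrier Q)) \<phi>"
  define \<epsilon> :: real where "\<epsilon> = 1 / (k + 1)"
  have \<epsilon>: "0 < \<epsilon>" by (simp add: \<epsilon>_def)
  have F: "approximate_family Q 0 label ?C \<epsilon> {[] :: nat list} (\<lambda>_ u. u)"
    using \<epsilon> by (simp add: approximate_family_def)
  have "real (card {i \<in> {[] :: nat list}. \<not> formally_true Q word \<phi> 0 label (\<lambda>v. word \<one>)})
      \<le> k * (\<epsilon> * card {[] :: nat list})"
    unfolding k_def
    by (rule sat_imp_mostly_formally_true[OF _ _ _ \<epsilon> F])
       (use \<phi> finite_constants label_closed reduced_word in auto)
  also have "\<dots> < 1" by (simp add: \<epsilon>_def)
  finally have "card {i \<in> {[] :: nat list}. \<not> formally_true Q word \<phi> 0 label (\<lambda>v. word \<one>)} = 0"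
    by linarith
  then show ?thesis by (auto simp: word_one split: if_splits)
qed

end

section \<open>Homomorphisms out of a free product\<close>

text \<open>
  Words that need not be alternating. They are closed under concatenation, unlike the normal forms.
\<close>

definition tagged_words :: "'a set \<Rightarrow> 'a set \<Rightarrow> (bool \<times> 'a) list set" where
  "tagged_words H K = {w. \<forall>l \<in> set w. snd l \<in> (if fst l then H else K)}"

lemma alternating_words_iff:
  "w \<in> alternating_words G H K \<longleftrightarrow> w \<in> tagged_words H K \<and> (\<forall>l \<in> set w. snd l \<noteq> \<one>\<^bsub>G\<^esub>) \<and>
     successively (\<lambda>k l. fst k \<noteq> fst l) w"
  by (auto simp: alternating_words_def tagged_words_def)

lemma list_prod_simps [simp]: "list_prod G [] = \<one>\<^bsub>G\<^esub>"
  "list_prod G (g # gs) = g \<otimes>\<^bsub>G\<^esub> list_prod G gs"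
  by (simp_all add: list_prod_def)

text \<open>
  The universal property of the free product. A tagged word can be made alternating by merging
  neighbours with the same tag and dropping trivial entries, and these steps change neither its
  product in \<open>G\<close> nor the product of the images in \<open>L\<close>. As the normal form in \<open>G\<close> is unique, the latter
  depends on the former alone.
\<close>

lemma free_product_extend:
  assumes G: "group G" and L: "group L" and fp: "is_free_product G H K"
    and \<alpha>: "\<And>x. x \<in> H \<Longrightarrow> \<alpha> x \<in> carrier L" "\<And>x y. x \<in> H \<Longrightarrow> y \<in> H \<Longrightarrow> \<alpha> (x \<otimes>\<^bsub>G\<^esub> y) = \<alpha> x \<otimes>\<^bsub>L\<^esub> \<alpha> y"
    and \<beta>: "\<And>x. x \<in> K \<Longrightarrow> \<beta> x \<in> carrier L" "\<And>x y. x \<in> K \<Longrightarrow> y \<in> K \<Longrightarrow> \<beta> (x \<otimes>\<^bsub>G\<^esub> y) = \<beta> x \<otimes>\<^bsub>L\<^esub> \<beta> y"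
  obtains f where "f \<in> hom G L" "\<And>x. x \<in> H \<Longrightarrow> f x = \<alpha> x" "\<And>x. x \<in> K \<Longrightarrow> f x = \<beta> x"
proof -
  interpret G: group G by (rule G)
  interpret L: group L by (rule L)
  define D where "D t = (if t then H else K)" for t
  define \<gamma> where "\<gamma> l = (if fst l then \<alpha> else \<beta>) (snd l)" for l
  have D: "subgroup (D t) G" for t
    using fp by (simp add: is_free_product_def D_def)
  have DG: "x \<in> D t \<Longrightarrow> x \<in> carrier G" for x t
    using subgroup.mem_carrier[OF D] .
  have tagged: "w \<in> tagged_words H K \<longleftrightarrow> (\<forall>l \<in> set w. snd l \<in> D (fst l))" for w
    by (simp add: tagged_words_def D_def)
  have \<gamma>_mult: "\<gamma> (t, x \<otimes>\<^bsub>G\<^esub> y) = \<gamma> (t, x) \<otimes>\<^bsub>L\<^esub> \<gamma> (t, y)" if "x \<in> D t" "y \<in> D t" for t x y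
    using that \<alpha>(2) \<beta>(2) by (auto simp: \<gamma>_def D_def split: if_splits)
  have \<gamma>_closed: "\<gamma> l \<in> carrier L" if "snd l \<in> D (fst l)" for l
    using that \<alpha>(1) \<beta>(1) by (auto simp: \<gamma>_def D_def split: if_splits)
  have \<gamma>_one: "\<gamma> (t, \<one>\<^bsub>G\<^esub>) = \<one>\<^bsub>L\<^esub>" for t
  proof -
    have "\<one>\<^bsub>G\<^esub> \<in> D t" using D by (rule subgroup.one_closed)
    then show ?thesis
      using \<gamma>_mult[of "\<one>\<^bsub>G\<^esub>" t "\<one>\<^bsub>G\<^esub>"] \<gamma>_closed[of "(t, \<one>\<^bsub>G\<^esub>)"] by (simp add: L.l_cancel_one)
  qed
  define P where "P w = list_prod G (map snd w)" for w :: "(bool \<times> _) list"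
  define V where "V w = list_prod L (map \<gamma> w)" for w
  have P_closed: "P w \<in> carrier G" if "w \<in> tagged_words H K" for w
    unfolding P_def using that DG tagged by (intro G.list_prod_closed) auto
  have V_closed: "V w \<in> carrier L" if "w \<in> tagged_words H K" for w
    unfolding V_def using that \<gamma>_closed tagged by (intro L.list_prod_closed) auto
  have normalize: "\<exists>w' \<in> alternating_words G H K. P w' = P w \<and> V w' = V w"
    if "w \<in> tagged_words H K" for w
    using that
  proof (induction w)
    case Nil
    then show ?case by (intro bexI[of _ "[]"]) (auto simp: alternating_words_iff tagged_words_def)
  next
    case (Cons l w)
    obtain t x where l: "l = (t, x)" by (cases l)
    have x: "x \<in> D t" and w: "w \<in> tagged_words H K" using Cons.prems by (auto simp: tagged l)
    obtain w' where w': "w' \<in> alternating_words G H K" "P w' = P w" "V w' = V w"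
      using Cons.IH[OF w] by blast
    then have tw': "w' \<in> tagged_words H K" by (simp add: alternating_words_iff)
    have PV: "P (l # w) = x \<otimes>\<^bsub>G\<^esub> P w'" "V (l # w) = \<gamma> (t, x) \<otimes>\<^bsub>L\<^esub> V w'"
      using w' by (simp_all add: P_def V_def l)
    show ?case
    proof (cases "x = \<one>\<^bsub>G\<^esub>")
      case True
      then show ?thesis using w' PV P_closed[OF tw'] V_closed[OF tw'] \<gamma>_one by auto
    next
      case x1: False
      show ?thesis
      proof (cases "w' = [] \<or> fst (hd w') \<noteq> t")
        case True
        then have "l # w' \<in> alternating_words G H K"
          using w'(1) x x1 by (auto simp: alternating_words_iff tagged l successively_Cons)
        moreover have "P (l # w') = P (l # w)" "V (l # w') = V (l # w)"
          using PV by (simp_all add: P_def V_def l)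
        ultimately show ?thesis by blast
      next
        case False
        then obtain y u where wy: "w' = (t, y) # u" by (cases w') auto
        have y: "y \<in> D t" and u: "u \<in> tagged_words H K" and ua: "u \<in> alternating_words G H K"
          using tw' w'(1) by (auto simp: wy tagged alternating_words_iff successively_Cons)
        have xy: "x \<otimes>\<^bsub>G\<^esub> y \<in> D t" using subgroup.m_closed[OF D x y] .
        have PV': "P (l # w) = (x \<otimes>\<^bsub>G\<^esub> y) \<otimes>\<^bsub>G\<^esub> P u" "V (l # w) = \<gamma> (t, x \<otimes>\<^bsub>G\<^esub> y) \<otimes>\<^bsub>L\<^esub> V u"
          using PV DG[OF x] DG[OF y] P_closed[OF u] V_closed[OF u] \<gamma>_closed[of "(t, x)"]
            \<gamma>_closed[of "(t, y)"] x y
          by (simp_all add: wy P_def V_def \<gamma>_mult G.m_assoc L.m_assoc)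
        show ?thesis
        proof (cases "x \<otimes>\<^bsub>G\<^esub> y = \<one>\<^bsub>G\<^esub>")
          case True
          then show ?thesis using ua PV' P_closed[OF u] V_closed[OF u] \<gamma>_one by auto
        next
          case False
          then have "(t, x \<otimes>\<^bsub>G\<^esub> y) # u \<in> alternating_words G H K"
            using w'(1) xy by (auto simp: wy alternating_words_iff tagged successively_Cons)
          moreover have "P ((t, x \<otimes>\<^bsub>G\<^esub> y) # u) = P (l # w)" "V ((t, x \<otimes>\<^bsub>G\<^esub> y) # u) = V (l # w)"
            using PV' by (simp_all add: P_def V_def)
          ultimately show ?thesis by blast
        qed
      qed
    qed
  qed
  have bij: "bij_betw P (alternating_words G H K) (carrier G)"
    using fp by (simp add: is_free_product_def P_def[abs_def])
  define N where "N g = inv_into (alternating_words G H K) P g" for g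
  have N: "N g \<in> alternating_words G H K" "P (N g) = g" if "g \<in> carrier G" for g
    using that bij unfolding N_def bij_betw_def by (auto intro: inv_into_into f_inv_into_f)
  define f where "f g = V (N g)" for g
  have f: "f (P w) = V w" if w: "w \<in> tagged_words H K" for w
  proof -
    obtain w' where w': "w' \<in> alternating_words G H K" "P w' = P w" "V w' = V w"
      using normalize[OF w] by blast
    then have "N (P w) = w'"
      using bij N[OF P_closed[OF w]] by (metis bij_betw_imp_inj_on inj_onD)
    then show ?thesis using w'(3) by (simp add: f_def)
  qed
  have NT: "N g \<in> tagged_words H K" if "g \<in> carrier G" for g
    using N(1)[OF that] by (simp add: alternating_words_iff)
  show ?thesis
  proof (rule that)
    show "f \<in> hom G L"
    proof (rule homI)
      show "f g \<in> carrier L" if "g \<in> carrier G" for g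
        using V_closed[OF NT[OF that]] by (simp add: f_def)
      show "f (g \<otimes>\<^bsub>G\<^esub> h) = f g \<otimes>\<^bsub>L\<^esub> f h" if g: "g \<in> carrier G" and h: "h \<in> carrier G" for g h
      proof -
        have "N g @ N h \<in> tagged_words H K"
          using NT[OF g] NT[OF h] by (auto simp: tagged_words_def)
        moreover have "P (N g @ N h) = P (N g) \<otimes>\<^bsub>G\<^esub> P (N h)"
          unfolding P_def map_append
          by (rule G.list_prod_append) (use NT[OF g] NT[OF h] DG tagged in auto)
        moreover have "V (N g @ N h) = V (N g) \<otimes>\<^bsub>L\<^esub> V (N h)"
          unfolding V_def map_append
          by (rule L.list_prod_append) (use NT[OF g] NT[OF h] \<gamma>_closed tagged in auto)
        ultimately show ?thesis using f[of "N g @ N h"] N(2)[OF g] N(2)[OF h] by (simp add: f_def)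
      qed
    qed
    have single: "f x = \<gamma> (t, x)" if "x \<in> D t" for t x
      using f[of "[(t, x)]"] that DG[OF that] \<gamma>_closed[of "(t, x)"] by (simp add: tagged P_def V_def)
    show "f x = \<alpha> x" if "x \<in> H" for x
      using single[of x True] that by (simp add: D_def \<gamma>_def)
    show "f x = \<beta> x" if "x \<in> K" for x
      using single[of x False] that by (simp add: D_def \<gamma>_def)
  qed
qed

lemma hom_list_prod:
  assumes "group G" "group L" "f \<in> hom G L" "set gs \<subseteq> carrier G"
  shows "f (list_prod G gs) = list_prod L (map f gs)"
proof -
  interpret f: group_hom G L f by (simp add: assms group_hom.intro group_hom_axioms.intro)
  show ?thesis using assms(4)
    by (induction gs) (auto simp: f.G.list_prod_closed)
qed

lemma free_product_hom_eqI:
  assumes G: "group G" and L: "group L" and fp: "is_free_product G H K"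
    and f: "f \<in> hom G L" and h: "h \<in> hom G L" and eq: "\<And>x. x \<in> H \<union> K \<Longrightarrow> f x = h x"
    and g: "g \<in> carrier G"
  shows "f g = h g"
proof -
  have "g \<in> (\<lambda>w. list_prod G (map snd w)) ` alternating_words G H K"
    using g fp by (simp add: is_free_product_def bij_betw_def)
  then obtain w where w: "w \<in> alternating_words G H K" "g = list_prod G (map snd w)" by blast
  have HK: "set (map snd w) \<subseteq> H \<union> K"
    using w(1) by (auto simp: alternating_words_iff tagged_words_def split: if_splits)
  moreover have "H \<union> K \<subseteq> carrier G"
    using fp by (auto simp: is_free_product_def dest: subgroup.mem_carrier)
  ultimately have "set (map snd w) \<subseteq> carrier G" by blast
  then have "f g = list_prod L (map f (map snd w))" "h g = list_prod L (map h (map snd w))"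
    unfolding w(2) using hom_list_prod[OF G L] f h by blast+
  moreover have "map f (map snd w) = map h (map snd w)"
    using HK eq by (intro map_cong) auto
  ultimately show ?thesis by (simp only:)
qed

section \<open>The positive theories\<close>

text \<open>
  If there is at most one generator, all elements are powers of it.
\<close>

lemma (in free_group_on) ex_two_generators:
  assumes "\<not> comm_group G"
  shows "\<exists>a \<in> X. \<exists>b \<in> X. a \<noteq> b"
proof (rule ccontr)
  assume no: "\<not> ?thesis"
  obtain x where x: "x \<in> carrier G" "X \<subseteq> {x}"
  proof (cases "X = {}")
    case False
    then obtain x where "x \<in> X" by blast
    moreover from this have "x \<in> carrier G" using basis by (auto simp: free_basis_def)
    ultimately show ?thesis using no that by blast
  qed (use that in blast)
  have pow: "\<exists>k :: int. wval G gen u = x [^] k" if "gens u \<subseteq> Inl ` X" for u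
    using that
  proof (induction u)
    case Nil
    then show ?case by (intro exI[of _ 0]) simp
  next
    case (Cons l u)
    then obtain k :: int where k: "wval G gen u = x [^] k" by auto
    have "gen (snd l) = x" using Cons.prems x by (auto simp: gen_def)
    then have "wval G gen (l # u) = x [^] ((if fst l then 1 else - 1) + k)"
      using k x(1) by (auto simp: wval_Cons letter_val_def int_pow_mult int_pow_neg int_pow_1)
    then show ?case by blast
  qed
  have "comm_group G"
  proof (rule group_comm_groupI)
    fix g h assume "g \<in> carrier G" "h \<in> carrier G"
    then obtain i j :: int where "g = x [^] i" "h = x [^] j"
      using pow gens_word wval_word by metis
    then show "g \<otimes> h = h \<otimes> g"
      using x(1) by (simp add: add.commute flip: int_pow_mult)
  qed
  with assms show False by blast
qed

text \<open>
  It suffices that \<open>H\<close> is an arbitrary group over \<open>Q\<close> that contains \<open>A\<close>. By soundness it is enough to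
  map \<open>G\<close> to \<open>H\<close> over \<open>Q\<close> such that \<open>A\<close> is fixed. Sending each basis element of \<open>G\<close> to an element of \<open>H\<close>
  with the same value in \<open>Q\<close> gives a homomorphism \<open>\<theta>\<close> over \<open>Q\<close>, but it need not fix \<open>A\<close>. So it is kept
  only on the complementary factor \<open>B\<close> and combined with the inclusion of \<open>A\<close>.
\<close>

lemma positive_theory_subset:
  fixes Q :: "('q, 'n) monoid_scheme"
    and G :: "('a, 'm1) monoid_scheme" and H :: "('a, 'm2) monoid_scheme"
    and \<pi> \<rho> :: "'a \<Rightarrow> 'q" and A :: "'a set"
  assumes Q: "group Q" "finite (carrier Q)"
    and G: "free_group G" "\<not> comm_group G" "free_factor A G"
    and H: "group H" "A \<subseteq> carrier H"
    and mult: "\<And>a b. a \<in> A \<Longrightarrow> b \<in> A \<Longrightarrow> a \<otimes>\<^bsub>G\<^esub> b = a \<otimes>\<^bsub>H\<^esub> b"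
    and \<pi>: "\<pi> \<in> epi G Q" and \<rho>: "\<rho> \<in> epi H Q"
    and label: "\<And>a. a \<in> A \<Longrightarrow> \<pi> a = \<rho> a"
  shows "positive_theory Q A G \<pi> \<subseteq> positive_theory Q A H \<rho>"
proof
  fix \<phi> assume \<phi>: "\<phi> \<in> positive_theory Q A G \<pi>"
  have gG: "group G" using G(1) by (simp add: free_group_def)
  obtain X where X: "free_basis G X" using G(1) by (auto simp: free_group_def)
  interpret G: free_group_on G X
    by (intro free_group_on.intro free_group_on_axioms.intro gG X)
  obtain a b where ab: "a \<in> X" "b \<in> X" "a \<noteq> b" using G.ex_two_generators[OF G(2)] by blast
  interpret G: labelled_free_group G X Q \<pi> a b
    by (intro labelled_free_group.intro labelled_free_group_axioms.intro)
       (use G.free_group_on_axioms Q \<pi> ab in auto)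
  obtain B where fp: "is_free_product G A B" using G(3) by (auto simp: free_factor_def)
  then have A: "subgroup A G" and B: "subgroup B G" by (simp_all add: is_free_product_def)
  have \<rho>_hom: "\<rho> \<in> hom H Q" using \<rho> by (simp add: epi_def)

  obtain l where l: "\<And>p. p \<in> carrier Q \<Longrightarrow> l p \<in> carrier H \<and> \<rho> (l p) = p"
  proof -
    have "carrier Q = \<rho> ` carrier H" using \<rho> by (simp add: epi_def)
    then have "\<forall>p \<in> carrier Q. \<exists>y. y \<in> carrier H \<and> \<rho> y = p" by auto
    then show ?thesis using that by metis
  qed
  define t where "t y = l (G.label y)" for y
  have t: "\<forall>y. t y \<in> carrier H" "\<rho> \<circ> t = G.label"
    using l G.label_closed by (auto simp: t_def)
  define \<theta> where "\<theta> g = wval H t (G.word g)" for g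
  have \<theta>: "\<theta> g \<in> carrier H" "\<rho> (\<theta> g) = \<pi> g" if "g \<in> carrier G" for g
    using that t(1) hom_wval[OF H(1) Q(1) \<rho>_hom t(1)] G.wval_label
    by (simp_all add: \<theta>_def group.wval_closed[OF H(1)] t(2) G.wval_word)
  have \<theta>_mult: "\<theta> (g \<otimes>\<^bsub>G\<^esub> h) = \<theta> g \<otimes>\<^bsub>H\<^esub> \<theta> h" if "g \<in> carrier G" "h \<in> carrier G" for g h
    using that by (simp add: \<theta>_def G.word_mult group.wval_nf[OF H(1) t(1)]
        group.wval_append[OF H(1) t(1)])

  obtain f where f: "f \<in> hom G H" "\<And>x. x \<in> A \<Longrightarrow> f x = x" "\<And>x. x \<in> B \<Longrightarrow> f x = \<theta> x"
    using free_product_extend[OF gG H(1) fp, of "\<lambda>x. x" \<theta>] H(2) mult \<theta>(1) \<theta>_mult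
      subgroup.mem_carrier[OF B] by blast
  have fl: "\<rho> (f g) = \<pi> g" if g: "g \<in> carrier G" for g
  proof -
    have "\<rho> \<circ> f \<in> hom G Q" using f(1) \<rho>_hom by (rule hom_compose)
    then have "(\<rho> \<circ> f) g = \<pi> g"
      by (rule free_product_hom_eqI[OF gG Q(1) fp _ G.\<pi>_hom _ g])
         (use f \<theta>(2) label subgroup.mem_carrier[OF B] in auto)
    then show ?thesis by simp
  qed

  have sent: "free_vars \<phi> = {}" "constants \<phi> \<subseteq> A" "positive \<phi>" "holds G \<pi> \<phi>"
    using \<phi> by (simp_all add: positive_theory_def LQ_sentences_def)
  have AG: "A \<subseteq> carrier G" using A by (rule subgroup.subset)
  have "sat G \<pi> (\<lambda>_. \<one>\<^bsub>G\<^esub>) \<phi>" using sent(4) by (auto simp: holds_def)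
  then have formal: "formally_true Q G.word \<phi> 0 G.label (\<lambda>_. [])"
    using sent(2,3) AG by (intro G.sat_imp_formally_true) auto
  have "sat H \<rho> (\<lambda>v. wval H (f \<circ> G.gen) []) \<phi>"
  proof (rule formally_true_sound[OF H(1) Q(1) \<rho>_hom _ _ _ _ formal])
    show "\<forall>y. (f \<circ> G.gen) y \<in> carrier H" using f(1) G.gen_closed by (auto simp: hom_def)
    show "\<rho> \<circ> (f \<circ> G.gen) = G.label" using fl G.gen_closed by auto
    show "below 0 []" by (simp add: below_def)
    fix c assume c: "c \<in> constants \<phi>"
    then have cG: "c \<in> carrier G" using sent(2) AG by blast
    have "wval H (f \<circ> G.gen) (G.word c) = f (wval G G.gen (G.word c))"
      using hom_wval[OF gG H(1) f(1) G.gen_closed] by simp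
    then show "wval H (f \<circ> G.gen) (G.word c) = c \<and> below 0 (G.word c)"
      using c cG sent(2) f(2) by (auto simp: G.wval_word G.below_word)
  qed
  then have "holds H \<rho> \<phi>"
    unfolding holds_def using sat_cong[of \<phi>] sent(1) by (metis empty_iff)
  then show "\<phi> \<in> positive_theory Q A H \<rho>"
    using \<phi> by (simp add: positive_theory_def)
qed

theorem mainTheorem1:
  fixes Q :: "('q, 'n) monoid_scheme"
    and F\<^sub>1 :: "('a, 'm1) monoid_scheme" and F\<^sub>2 :: "('a, 'm2) monoid_scheme"
    and \<pi>\<^sub>1 \<pi>\<^sub>2 :: "'a \<Rightarrow> 'q" and A :: "'a set"
  assumes "group Q" and "finite (carrier Q)"
    and "free_group F\<^sub>1" and "finitely_generated F\<^sub>1" and "\<not> comm_group F\<^sub>1"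
    and "free_group F\<^sub>2" and "finitely_generated F\<^sub>2" and "\<not> comm_group F\<^sub>2"
    and "free_factor A F\<^sub>1" and "free_factor A F\<^sub>2"
    and "\<And>a b. a \<in> A \<Longrightarrow> b \<in> A \<Longrightarrow> a \<otimes>\<^bsub>F\<^sub>1\<^esub> b = a \<otimes>\<^bsub>F\<^sub>2\<^esub> b"
    and "\<pi>\<^sub>1 \<in> epi F\<^sub>1 Q" and "\<pi>\<^sub>2 \<in> epi F\<^sub>2 Q"
    and "\<And>a. a \<in> A \<Longrightarrow> \<pi>\<^sub>1 a = \<pi>\<^sub>2 a"
  shows "positive_theory Q A F\<^sub>1 \<pi>\<^sub>1 = positive_theory Q A F\<^sub>2 \<pi>\<^sub>2"
proof
  have A: "A \<subseteq> carrier F\<^sub>1" "A \<subseteq> carrier F\<^sub>2"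
    using assms(9,10) by (auto simp: free_factor_def is_free_product_def dest: subgroup.subset)
  have F: "group F\<^sub>1" "group F\<^sub>2"
    using assms(3,6) by (simp_all add: free_group_def)
  show "positive_theory Q A F\<^sub>1 \<pi>\<^sub>1 \<subseteq> positive_theory Q A F\<^sub>2 \<pi>\<^sub>2"
    using assms A F by (intro positive_theory_subset) auto
  show "positive_theory Q A F\<^sub>2 \<pi>\<^sub>2 \<subseteq> positive_theory Q A F\<^sub>1 \<pi>\<^sub>1"
    using assms A F by (intro positive_theory_subset) auto
qed

end
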